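(* Let $G$ be a finite solvable group. If at least one of the following holds: (1) $\mathrm{acd}_{\mathbb{Q},2'}(G) < 2$, (2) $\mathrm{acd}_{\mathbb{Q}}(G) < 2$, (3) $\mathrm{acd}_{\mathbb{R},2'}(G) < 2$, (4) $\mathrm{acd}_{\mathbb{R}}(G) < 2$, then $G$ is $2$-nilpotent.
   Context: $\mathrm{Irr}(G)$ denotes the set of irreducible complex characters of the finite group $G$. For a subfield $k$ of $\mathbb{C}$ and a prime $p$, $\mathrm{Irr}_k(G)$ is the set of $\chi\in\mathrm{Irr}(G)$ all of whose values lie in $k$, and $\mathrm{Irr}_{k,p'}(G)$ is the set of $\chi\in\mathrm{Irr}_k(G)$ whose degree $\chi(1)$ is not divisible by $p$. $\mathrm{acd}_k(G)$ and $\mathrm{acd}_{k,p'}(G)$ denote the average of the degrees $\chi(1)$ over $\chi\in\mathrm{Irr}_k(G)$ and over $\chi\in\mathrm{Irr}_{k,p'}(G)$, respectively. $G$ is $p$-nilpotent if it has a normal $p$-complement, i.e. a normal subgroup of order prime to $p$ and of index a power of $p$. *)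

theory Defs
  imports
    Complex_Main
    "HOL-Algebra.Coset"
    "HOL-Algebra.Solvable_Groups"
    "HOL-Computational_Algebra.Primes"
    "Jordan_Normal_Form.VS_Connect"
begin

definition GL :: "nat \<Rightarrow> complex mat monoid" where
  "GL n = units_of (ring_mat TYPE(complex) n ())"

definition mat_trace :: "complex mat \<Rightarrow> complex" where
  "mat_trace A = (\<Sum>i<dim_row A. A $$ (i, i))"

definition invariant_subspace ::
  "('a, 'b) monoid_scheme \<Rightarrow> nat \<Rightarrow> ('a \<Rightarrow> complex mat) \<Rightarrow> complex vec set \<Rightarrow> bool" where
  "invariant_subspace G n \<rho> W \<longleftrightarrow>
     VectorSpace.subspace class_ring W (module_vec TYPE(complex) n) \<and>
     (\<forall>g\<in>carrier G. \<forall>w\<in>W. \<rho> g *\<^sub>v w \<in> W)"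

definition irreducible_rep ::
  "('a, 'b) monoid_scheme \<Rightarrow> nat \<Rightarrow> ('a \<Rightarrow> complex mat) \<Rightarrow> bool" where
  "irreducible_rep G n \<rho> \<longleftrightarrow>
     n > 0 \<and> \<rho> \<in> hom G (GL n) \<and>
     (\<forall>W. invariant_subspace G n \<rho> W \<longrightarrow> W = {0\<^sub>v n} \<or> W = carrier_vec n)"

text \<open>Characters are functions on the carrier. They are made extensional so that two characters
  are equal exactly when they agree on the group, and each one is counted once.\<close>

definition rep_char ::
  "('a, 'b) monoid_scheme \<Rightarrow> ('a \<Rightarrow> complex mat) \<Rightarrow> 'a \<Rightarrow> complex" where
  "rep_char G \<rho> = (\<lambda>g\<in>carrier G. mat_trace (\<rho> g))"

definition Irr :: "('a, 'b) monoid_scheme \<Rightarrow> ('a \<Rightarrow> complex) set" where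
  "Irr G = {rep_char G \<rho> | n \<rho>. irreducible_rep G n \<rho>}"

text \<open>The value of a character at the identity is a natural number, read here as a \<open>nat\<close>.\<close>

definition char_degree :: "('a, 'b) monoid_scheme \<Rightarrow> ('a \<Rightarrow> complex) \<Rightarrow> nat" where
  "char_degree G \<chi> = (THE d. \<chi> \<one>\<^bsub>G\<^esub> = of_nat d)"

definition Irr_over :: "complex set \<Rightarrow> ('a, 'b) monoid_scheme \<Rightarrow> ('a \<Rightarrow> complex) set" where
  "Irr_over k G = {\<chi> \<in> Irr G. \<forall>g\<in>carrier G. \<chi> g \<in> k}"

definition Irr_over_p' ::
  "complex set \<Rightarrow> nat \<Rightarrow> ('a, 'b) monoid_scheme \<Rightarrow> ('a \<Rightarrow> complex) set" where
  "Irr_over_p' k p G = {\<chi> \<in> Irr_over k G. \<not> p dvd char_degree G \<chi>}"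

definition average_degree ::
  "('a, 'b) monoid_scheme \<Rightarrow> ('a \<Rightarrow> complex) set \<Rightarrow> real" where
  "average_degree G X = (\<Sum>\<chi>\<in>X. real (char_degree G \<chi>)) / real (card X)"

definition acd :: "complex set \<Rightarrow> ('a, 'b) monoid_scheme \<Rightarrow> real" where
  "acd k G = average_degree G (Irr_over k G)"

definition acd_p' :: "complex set \<Rightarrow> nat \<Rightarrow> ('a, 'b) monoid_scheme \<Rightarrow> real" where
  "acd_p' k p G = average_degree G (Irr_over_p' k p G)"

definition p_nilpotent :: "nat \<Rightarrow> ('a, 'b) monoid_scheme \<Rightarrow> bool" where
  "p_nilpotent p G \<longleftrightarrow>
     (\<exists>N. N \<lhd> G \<and> coprime (card N) p \<and> (\<exists>a. card (rcosets\<^bsub>G\<^esub> N) = p ^ a))"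

end

theory Submission
  imports
    Defs
    "HOL-Algebra.Group_Action"
    "HOL-Algebra.Sylow"
    "HOL-Algebra.Multiplicative_Group"
    "Jordan_Normal_Form.Schur_Decomposition"
begin

text \<open>Suppose that \<open>G\<close> is solvable but not 2-nilpotent. It suffices to find a nonlinear irreducible character
  \<open>\<chi>\<close> of odd degree with integer values that does not vanish on elements of 2-power order:
  then \<open>\<mu> \<mapsto> \<mu>\<chi>\<close> embeds the real linear characters into the rational (or real) characters of odd
  degree at least 3, so the average degree is at least 2.

  To construct \<open>\<chi>\<close>, pass to a quotient of \<open>G\<close> that is not 2-nilpotent but whose proper quotients are. A minimal
  normal subgroup \<open>N\<close> is then an elementary abelian 2-group, and the Frattini argument, applied to
  a chief factor \<open>R/N\<close> of odd order and a Sylow subgroup \<open>S\<close> of \<open>R\<close>, shows that the normalizer of \<open>S\<close>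
  is a complement of \<open>N\<close>. As the number of nontrivial characters of \<open>N\<close> is odd, one of
  them has a stabilizer \<open>T\<close> of odd index. It extends to a sign character of \<open>T\<close>, trivial on the complement, and
  \<open>\<chi>\<close> is the character induced from this extension.\<close>

section \<open>Group actions, homomorphisms and elements of prime order\<close>

text \<open>The bound 2 is the mean of 1 and 3: each linear character is paired with its product
  with \<chi>, and every other character has degree at least 2. Nonvanishing on 2-elements makes the
  pairing injective. A real linear character takes only the values 1 and -1, so its value at
  \<open>g\<close> is already its value at \<open>g [^] m\<close> for the odd part \<open>m\<close>
  of the group order, and there one may divide by \<chi>. Odd degree has two uses. It keeps the
  products inside both the odd-degree sets and the full sets, so that one argument covers all four
  averages. It also gives nonvanishing: a 2-element has an odd number of fixed points on an odd
  number of cosets, and each contributes a sign to the value of \<chi>. In general a sign character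
  of \<open>N\<close> need not extend to its stabilizer \<open>T\<close>. A complement
  \<open>M\<close> of \<open>N\<close> removes this obstacle, because every element of
  \<open>T\<close> is then uniquely a product of an element of \<open>N\<close> and an element of
  \<open>M\<close> that fixes the sign character.\<close>

lemma (in group) inv_mult_cancel:
  assumes "x \<in> carrier G" "y \<in> carrier G"
  shows "inv x \<otimes> (x \<otimes> y) = y" "x \<otimes> (inv x \<otimes> y) = y"
  using assms by (simp_all add: m_assoc[symmetric])

text \<open>A \<open>group_action\<close> is a homomorphism into \<open>BijGroup E\<close>, whose
  elements are extensional. Restricting to \<open>E\<close> lets the actions below be given by
  ordinary formulas; \<open>act (inv g)\<close> provides the inverse of
  \<open>act g\<close>.\<close>

lemma (in group) group_action_restrictI:
  assumes closed: "\<And>g x. g \<in> carrier G \<Longrightarrow> x \<in> E \<Longrightarrow> act g x \<in> E"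
    and one: "\<And>x. x \<in> E \<Longrightarrow> act \<one> x = x"
    and mult: "\<And>g h x. g \<in> carrier G \<Longrightarrow> h \<in> carrier G \<Longrightarrow> x \<in> E \<Longrightarrow> act (g \<otimes> h) x = act g (act h x)"
  shows "group_action G E (\<lambda>g. restrict (act g) E)"
proof -
  have inverse: "act (inv g) (act g x) = x" if "g \<in> carrier G" "x \<in> E" for g x
    using mult[of "inv g" g x] one that by simp
  have "bij_betw (act g) E E" if g: "g \<in> carrier G" for g
    by (rule bij_betw_byWitness[where f' = "act (inv g)"])
      (use g closed inverse[of g] inverse[of "inv g"] in auto)
  then have "restrict (act g) E \<in> Bij E" if "g \<in> carrier G" for g
    using that by (simp add: Bij_def)
  moreover have "restrict (act (g \<otimes> h)) E = compose E (restrict (act g) E) (restrict (act h) E)"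
    if "g \<in> carrier G" "h \<in> carrier G" for g h
    using that closed mult by (auto simp: compose_def fun_eq_iff)
  ultimately have "(\<lambda>g. restrict (act g) E) \<in> hom G (BijGroup E)"
    by (auto simp: hom_def BijGroup_def)
  then show ?thesis
    by (simp add: group_action_def group_hom_def group_hom_axioms_def group_BijGroup is_group)
qed

text \<open>The orbits partition \<open>E\<close>, so \<open>p\<close> fails to divide the length of
  one of them, and that length is the index of a stabilizer.\<close>

lemma (in group) ex_stabilizer_index_not_dvd:
  assumes "finite (carrier G)" and "finite E"
    and "\<And>g x. g \<in> carrier G \<Longrightarrow> x \<in> E \<Longrightarrow> act g x \<in> E"
    and "\<And>x. x \<in> E \<Longrightarrow> act \<one> x = x"
    and "\<And>g h x. g \<in> carrier G \<Longrightarrow> h \<in> carrier G \<Longrightarrow> x \<in> E \<Longrightarrow> act (g \<otimes> h) x = act g (act h x)"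
    and "\<not> p dvd card E"
  obtains x where "x \<in> E" "subgroup {g \<in> carrier G. act g x = x} G"
    "\<not> p dvd card (rcosets {g \<in> carrier G. act g x = x})"
proof -
  let ?\<phi> = "\<lambda>g. restrict (act g) E"
  interpret A: group_action G E ?\<phi>
    by (rule group_action_restrictI) (use assms in auto)
  have "card E = (\<Sum>C\<in>orbits G E ?\<phi>. card C)"
    using A.disjoint_sum[of "\<lambda>_. 1::nat"] assms(2) by simp
  then obtain C where "C \<in> orbits G E ?\<phi>" and nd: "\<not> p dvd card C"
    using assms(6) by (metis dvd_sum)
  then obtain x where x: "x \<in> E" and C: "C = orbit G ?\<phi> x"
    by (auto simp: orbits_def)
  have stab: "stabilizer G ?\<phi> x = {g \<in> carrier G. act g x = x}"
    using x by (auto simp: stabilizer_def)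
  show thesis
  proof
    show "x \<in> E" by fact
    show "subgroup {g \<in> carrier G. act g x = x} G"
      using A.stabilizer_subgroup[OF x] stab by simp
    have "card (rcosets stabilizer G ?\<phi> x) = card C"
      using A.orbit_stab_fun_is_bij[OF x] bij_betw_same_card C by blast
    then show "\<not> p dvd card (rcosets {g \<in> carrier G. act g x = x})"
      using nd stab by simp
  qed
qed

text \<open>In a p-group every index is a power of \<open>p\<close>, so an orbit whose length is not
  divisible by \<open>p\<close> is a single point.\<close>

lemma (in group) p_group_fixed_point:
  assumes "prime p" and "Coset.order G = p ^ b" and "finite E"
    and "\<And>g x. g \<in> carrier G \<Longrightarrow> x \<in> E \<Longrightarrow> act g x \<in> E"
    and "\<And>x. x \<in> E \<Longrightarrow> act \<one> x = x"
    and "\<And>g h x. g \<in> carrier G \<Longrightarrow> h \<in> carrier G \<Longrightarrow> x \<in> E \<Longrightarrow> act (g \<otimes> h) x = act g (act h x)"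
    and "\<not> p dvd card E"
  obtains x where "x \<in> E" "\<And>g. g \<in> carrier G \<Longrightarrow> act g x = x"
proof -
  have fin: "finite (carrier G)"
    using assms(2) order_gt_0_iff_finite prime_gt_0_nat[OF assms(1)] by simp
  obtain x where x: "x \<in> E" and sub: "subgroup {g \<in> carrier G. act g x = x} G"
    and nd: "\<not> p dvd card (rcosets {g \<in> carrier G. act g x = x})"
    by (rule ex_stabilizer_index_not_dvd[OF fin assms(3-7)])
  let ?S = "{g \<in> carrier G. act g x = x}"
  have "card (rcosets ?S) dvd p ^ b"
    unfolding assms(2)[symmetric] lagrange[OF sub, symmetric] by (rule dvd_triv_left)
  then obtain i where i: "card (rcosets ?S) = p ^ i"
    using divides_primepow_nat[OF assms(1)] by blast
  with nd have "i = 0" by (cases i) simp_all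
  then have "card ?S = card (carrier G)"
    using i lagrange[OF sub] unfolding Coset.order_def by simp
  then have "?S = carrier G" by (intro card_subset_eq[OF fin]) blast+
  with x that show thesis by blast
qed

section \<open>Orders of images and preimages under homomorphisms\<close>

lemma (in group_hom) card_vimage:
  assumes "h ` carrier G = carrier H" and fin: "finite (carrier G)" and L: "L \<subseteq> carrier H"
  shows "card {g \<in> carrier G. h g \<in> L} = card L * card (kernel G H h)"
proof -
  have fL: "finite L" using finite_imageI[OF fin, of h] assms(1) finite_subset[OF L] by simp
  have fibre: "card {g \<in> carrier G. h g = l} = card (kernel G H h)" if l: "l \<in> L" for l
  proof -
    have "l \<in> h ` carrier G" using l L unfolding assms(1) by (rule subsetD[rotated])
    then obtain g0 where g0: "g0 \<in> carrier G" "h g0 = l" by blast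
    have "bij_betw (\<lambda>k. g0 \<otimes> k) (kernel G H h) {g \<in> carrier G. h g = l}"
    proof (rule bij_betw_byWitness[where f' = "\<lambda>g. inv g0 \<otimes> g"])
      show "\<forall>k\<in>kernel G H h. inv g0 \<otimes> (g0 \<otimes> k) = k"
        using g0(1) by (simp add: kernel_def G.m_assoc[symmetric])
      show "\<forall>g\<in>{g \<in> carrier G. h g = l}. g0 \<otimes> (inv g0 \<otimes> g) = g"
        using g0(1) by (simp add: G.m_assoc[symmetric])
      show "(\<otimes>) g0 ` kernel G H h \<subseteq> {g \<in> carrier G. h g = l}"
        using g0 by (auto simp: kernel_def)
      show "(\<otimes>) (inv g0) ` {g \<in> carrier G. h g = l} \<subseteq> kernel G H h"
        using g0 by (auto simp: kernel_def)
    qed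
    then show ?thesis by (rule bij_betw_same_card[symmetric])
  qed
  have "{g \<in> carrier G. h g \<in> L} = (\<Union>l\<in>L. {g \<in> carrier G. h g = l})" by auto
  also have "card \<dots> = (\<Sum>l\<in>L. card {g \<in> carrier G. h g = l})"
    by (rule card_UN_disjoint) (use fL fin in auto)
  finally have "card {g \<in> carrier G. h g \<in> L} = (\<Sum>l\<in>L. card {g \<in> carrier G. h g = l})" .
  then show ?thesis using fibre by simp
qed

lemma (in group_hom) subgroup_vimage:
  assumes "subgroup L H"
  shows "subgroup {g \<in> carrier G. h g \<in> L} G"
proof -
  have "\<one> \<in> {g \<in> carrier G. h g \<in> L}" using subgroup.one_closed[OF assms] by simp
  then show ?thesis
    by (intro G.subgroupI) (auto simp: subgroup.m_closed[OF assms] subgroup.m_inv_closed[OF assms])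
qed

lemma (in group_hom) normal_vimage:
  assumes "L \<lhd> H"
  shows "{g \<in> carrier G. h g \<in> L} \<lhd> G"
proof -
  have "subgroup L H" using assms normal_imp_subgroup by blast
  then have "subgroup {g \<in> carrier G. h g \<in> L} G" by (rule subgroup_vimage)
  moreover have "\<forall>x\<in>carrier G. \<forall>g\<in>{g \<in> carrier G. h g \<in> L}. x \<otimes> g \<otimes> inv x \<in> {g \<in> carrier G. h g \<in> L}"
    using assms unfolding H.normal_inv_iff by simp
  ultimately show ?thesis unfolding G.normal_inv_iff by blast
qed

lemma (in group_hom) normal_image:
  assumes "h ` carrier G = carrier H" "K \<lhd> G"
  shows "h ` K \<lhd> H"
  using assms normal.surj_hom_normal_subgroup[OF assms(2), of H h] group_hom_axioms by blast

text \<open>A subgroup that contains the kernel is a union of fibres, hence the full preimage of its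
  image, and \<open>card_vimage\<close> applies.\<close>

lemma (in group_hom) card_normal_image:
  assumes "h ` carrier G = carrier H" "finite (carrier G)" "subgroup K G" "kernel G H h \<subseteq> K"
  shows "card K = card (h ` K) * card (kernel G H h)"
proof -
  have Ksub: "K \<subseteq> carrier G" using assms(3) subgroup.subset by blast
  have sat: "g \<in> K" if "g \<in> carrier G" "k \<in> K" "h g = h k" for g k
  proof -
    have "inv k \<otimes> g \<in> kernel G H h" using that Ksub by (auto simp: kernel_def)
    then have "inv k \<otimes> g \<in> K" using assms(4) by blast
    then have "k \<otimes> (inv k \<otimes> g) \<in> K" using assms(3) that subgroup.m_closed by metis
    moreover have "k \<otimes> (inv k \<otimes> g) = g" using that Ksub by (auto simp: G.m_assoc[symmetric])
    ultimately show ?thesis by simp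
  qed
  have "{g \<in> carrier G. h g \<in> h ` K} = K" using Ksub by (blast intro: sat)
  moreover have "h ` K \<subseteq> carrier H" using Ksub by auto
  ultimately show ?thesis using card_vimage[OF assms(1,2)] by metis
qed

lemma (in normal) kernel_r_coset: "Coset.kernel G (G Mod H) (\<lambda>x. H #> x) = H"
proof (rule Set.set_eqI)
  fix x
  show "x \<in> Coset.kernel G (G Mod H) (\<lambda>x. H #> x) \<longleftrightarrow> x \<in> H"
  proof (cases "x \<in> carrier G")
    case True
    then have "H #> x = H \<longleftrightarrow> x \<in> H"
      using coset_join1[OF _ True subgroup_axioms] coset_join2[OF True subgroup_axioms] by blast
    with True show ?thesis by (simp add: kernel_def)
  next
    case False
    then have "x \<notin> H" using mem_carrier by blast
    with False show ?thesis by (simp add: kernel_def)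
  qed
qed

lemma (in group_hom) order_eq_mult_kernel:
  assumes "h ` carrier G = carrier H" "finite (carrier G)"
  shows "Coset.order G = Coset.order H * card (Coset.kernel G H h)"
proof -
  have "{g \<in> carrier G. h g \<in> carrier H} = carrier G" by auto
  then show ?thesis using card_vimage[OF assms subset_refl] by (simp add: Coset.order_def)
qed

lemma (in group_hom) card_kernel_neq_0:
  assumes "finite (carrier G)"
  shows "card (Coset.kernel G H h) \<noteq> 0"
proof -
  have "finite (Coset.kernel G H h)" using assms by (simp add: kernel_def)
  moreover have "\<one> \<in> Coset.kernel G H h" by (simp add: kernel_def)
  ultimately show ?thesis by auto
qed

section \<open>Lagrange, Cauchy and groups of prime exponent\<close>

lemma (in group) pow_card_subgroup:
  assumes "finite (carrier G)" "subgroup S G" "x \<in> S"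
  shows "x [^] card S = \<one>"
proof -
  interpret S: group "G\<lparr>carrier := S\<rparr>" using assms(2) subgroup_imp_group by blast
  have "finite S" using assms(1,2) finite_subset subgroup.subset by metis
  then have "x [^]\<^bsub>G\<lparr>carrier := S\<rparr>\<^esub> Coset.order (G\<lparr>carrier := S\<rparr>) = \<one>\<^bsub>G\<lparr>carrier := S\<rparr>\<^esub>"
    using S.pow_order_eq_1[of x] assms(3) by simp
  then show ?thesis by (simp add: Coset.order_def nat_pow_def)
qed

lemma (in group) eq_one_of_coprime_pow:
  assumes "x \<in> carrier G" "x [^] (m::nat) = \<one>" "x [^] (n::nat) = \<one>" "coprime m n"
  shows "x = \<one>"
proof -
  have "ord x dvd m" "ord x dvd n" using assms(2,3) pow_eq_id[OF assms(1)] by auto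
  then have "ord x = 1" using assms(4) coprime_common_divisor_nat by blast
  then show ?thesis using ord_eq_1[OF assms(1)] by simp
qed

lemma (in group) cauchy:
  assumes "finite (carrier G)" "subgroup N G" "prime p" "p dvd card N"
  obtains x where "x \<in> N" "x \<noteq> \<one>" "x [^] p = \<one>"
proof -
  interpret N: group "G\<lparr>carrier := N\<rparr>" using assms(2) subgroup_imp_group by blast
  have fN: "finite N" using assms(1,2) finite_subset subgroup.subset by metis
  \<comment> \<open>Sylow's theorem is used with exponent 1, where the cofactor \<open>m\<close> may
    again be divisible by \<open>p\<close>; this is Cauchy's theorem.\<close>
  obtain m where "card N = p ^ 1 * m" using assms(4) by auto
  then obtain P where P: "subgroup P (G\<lparr>carrier := N\<rparr>)" "card P = p ^ 1"
    using sylow_thm[OF assms(3) N.is_group, of 1 m] fN by (auto simp: Coset.order_def)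
  have PG: "subgroup P G" "P \<subseteq> N" using P(1) assms(2) incl_subgroup subgroup.subset by fastforce+
  have "\<not> P \<subseteq> {\<one>}" using P(2) prime_gt_1_nat[OF assms(3)] card_mono[of "{\<one>}" P] by force
  then obtain x where x: "x \<in> P" "x \<noteq> \<one>" by blast
  have "x [^] p = \<one>" using pow_card_subgroup[OF assms(1) PG(1) x(1)] P(2) by simp
  with x PG that show thesis by blast
qed

text \<open>By Cauchy, a prime divisor \<open>q\<close> other than \<open>p\<close> would give a
  nontrivial element whose order divides both \<open>q\<close> and \<open>p\<close>.\<close>

lemma (in group) prime_power_card:
  assumes "finite (carrier G)" "subgroup N G" "prime p" "\<forall>x\<in>N. x [^] p = \<one>"
  obtains b where "card N = p ^ b"
proof -
  have "q = p" if q: "prime q" "q dvd card N" for q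
  proof (rule ccontr)
    assume "q \<noteq> p"
    then have "coprime p q" using q assms(3) primes_coprime by blast
    obtain x where x: "x \<in> N" "x \<noteq> \<one>" "x [^] q = \<one>"
      using cauchy[OF assms(1,2) q] by blast
    have xG: "x \<in> carrier G" using x assms(2) subgroup.mem_carrier by metis
    have "x [^] p = \<one>" using x(1) assms(4) by blast
    with x show False using eq_one_of_coprime_pow[OF xG _ x(3) \<open>coprime p q\<close>] by blast
  qed
  moreover have "card N \<noteq> 0"
    using assms(1,2) by (metis card_0_eq empty_iff finite_subset subgroup.one_closed subgroup.subset)
  ultimately have "card N = p ^ multiplicity p (card N)"
  proof -
    assume a: "\<And>q. prime q \<Longrightarrow> q dvd card N \<Longrightarrow> q = p" and n: "card N \<noteq> 0"
    obtain m where m: "card N = p ^ multiplicity p (card N) * m" "\<not> p dvd m"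
      using multiplicity_decompose'[of "card N" p] n assms(3) by (metis not_prime_unit)
    have "m = 1"
    proof (rule ccontr)
      assume "m \<noteq> 1"
      then obtain q where "prime q" "q dvd m" using prime_factor_nat by blast
      with a[of q] m show False by (metis dvd_mult)
    qed
    with m show ?thesis by simp
  qed
  then show thesis using that by blast
qed

section \<open>Minimal normal subgroups and 2-nilpotent quotients\<close>

lemma (in group) ex_minimal_normal:
  assumes fin: "finite (carrier G)" and "M \<lhd> G" "M \<noteq> {\<one>}"
  obtains N where "N \<lhd> G" "N \<subseteq> M" "N \<noteq> {\<one>}" "\<And>L. L \<lhd> G \<Longrightarrow> L \<subseteq> N \<Longrightarrow> L = {\<one>} \<or> L = N"
proof -
  let ?P = "\<lambda>N. N \<lhd> G \<and> N \<subseteq> M \<and> N \<noteq> {\<one>}"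
  obtain N where N: "?P N" and least: "\<And>L. ?P L \<Longrightarrow> card N \<le> card L"
    using ex_has_least_nat[of ?P M card] assms(2,3) by blast
  have finN: "finite N"
    using N fin finite_subset normal_imp_subgroup subgroup.subset by metis
  have "L = N" if "L \<lhd> G" "L \<subseteq> N" "L \<noteq> {\<one>}" for L
    using least[of L] that N card_seteq[OF finN] by blast
  with N that show thesis by blast
qed

lemma (in group) conj_nat_pow:
  assumes "g \<in> carrier G" "x \<in> carrier G"
  shows "(g \<otimes> x \<otimes> inv g) [^] (n::nat) = g \<otimes> x [^] n \<otimes> inv g"
proof (induction n)
  case (Suc n)
  have "g \<otimes> x [^] n \<otimes> inv g \<otimes> (g \<otimes> x \<otimes> inv g) = g \<otimes> x [^] n \<otimes> (inv g \<otimes> g) \<otimes> x \<otimes> inv g"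
    using assms by (simp only: m_assoc m_closed inv_closed nat_pow_closed)
  with Suc assms show ?case by (simp add: m_assoc)
qed (use assms in simp)

text \<open>The derived subgroup of \<open>N\<close> is normal in \<open>G\<close>, so minimality
  makes it trivial or all of \<open>N\<close>. In the second case the derived series of
  \<open>G\<close> would never descend below \<open>N\<close>, against solvability.\<close>

lemma (in group) minimal_normal_commute:
  assumes "solvable G" "N \<lhd> G" "N \<noteq> {\<one>}"
    and min: "\<And>L. L \<lhd> G \<Longrightarrow> L \<subseteq> N \<Longrightarrow> L = {\<one>} \<or> L = N"
    and xy: "x \<in> N" "y \<in> N"
  shows "x \<otimes> y = y \<otimes> x"
proof -
  have N: "subgroup N G" using assms(2) by (rule normal_imp_subgroup)
  have "derived G N \<noteq> N"
  proof
    assume d: "derived G N = N"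
    obtain n where n: "(derived G ^^ n) (carrier G) = {\<one>}"
      using assms(1) solvable_iff_trivial_derived_seq by blast
    have "(derived G ^^ n) N = N" by (induction n) (simp_all add: d)
    with n mono_exp_of_derived[OF subgroup.subset[OF N], of n] have "N \<subseteq> {\<one>}" by simp
    with assms(3) subgroup.one_closed[OF N] show False by blast
  qed
  with min[OF derived_is_normal[OF assms(2)] derived_incl[OF subset_refl N]]
  have "derived G N = {\<one>}" by blast
  moreover have "x \<otimes> y \<otimes> inv x \<otimes> inv y \<in> derived G N"
    unfolding derived_def using xy by (intro generate.incl) blast
  ultimately have "x \<otimes> y \<otimes> inv x \<otimes> inv y = \<one>" by blast
  moreover have "x \<in> carrier G" "y \<in> carrier G" using xy N subgroup.mem_carrier by metis+
  ultimately show ?thesis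
    by (metis inv_closed inv_equality inv_inv inv_mult_group m_assoc m_closed)
qed

text \<open>In the commutative group \<open>N\<close> the solutions of
  \<open>x [^] p = \<one>\<close> form a subgroup stable under conjugation, and by Cauchy it is
  nontrivial when \<open>p\<close> divides the order of \<open>N\<close>.\<close>

lemma (in group) minimal_normal_exponent:
  assumes "finite (carrier G)" "N \<lhd> G" "N \<noteq> {\<one>}"
    and min: "\<And>L. L \<lhd> G \<Longrightarrow> L \<subseteq> N \<Longrightarrow> L = {\<one>} \<or> L = N"
    and comm: "\<And>x y. x \<in> N \<Longrightarrow> y \<in> N \<Longrightarrow> x \<otimes> y = y \<otimes> x"
  obtains p :: nat where "prime p" "\<forall>x\<in>N. x [^] p = \<one>"
proof -
  interpret N: normal N G by fact
  have "card N \<noteq> 1"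
    using assms(3) N.one_closed by (metis card_1_singletonE singletonD)
  then obtain p where p: "prime p" "p dvd card N" using prime_factor_nat by blast
  let ?L = "{x \<in> N. x [^] p = \<one>}"
  have "subgroup ?L G"
  proof (rule subgroupI)
    show "?L \<subseteq> carrier G" using N.subset by blast
    have "\<one> \<in> ?L" using N.one_closed by simp
    then show "?L \<noteq> {}" by blast
    fix x assume x: "x \<in> ?L"
    then have xG: "x \<in> carrier G" using N.subset by blast
    show "inv x \<in> ?L" using x nat_pow_inv[OF xG] by simp
    fix y assume y: "y \<in> ?L"
    then have "y \<in> carrier G" using N.subset by blast
    then show "x \<otimes> y \<in> ?L" using x y xG pow_mult_distrib[OF comm[of x y] xG] by simp
  qed
  moreover have "g \<otimes> x \<otimes> inv g \<in> ?L" if "g \<in> carrier G" "x \<in> ?L" for g x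
    using that N.inv_op_closed2[of g x] conj_nat_pow[of g x p] N.subset by auto
  ultimately have "?L \<lhd> G" unfolding normal_inv_iff by blast
  moreover obtain x where "x \<in> ?L" "x \<noteq> \<one>"
    using cauchy[OF assms(1) N.subgroup_axioms p] by blast
  ultimately have "?L = N" using min[of ?L] by blast
  then show thesis by (intro that[OF p(1)]) blast
qed

text \<open>This expresses 2-nilpotency of \<open>G/N\<close> inside \<open>G\<close>: \<open>K\<close> is the preimage of the normal 2-complement.
  Working with such \<open>N\<close> in a fixed group replaces an induction over groups of different types.\<close>

definition rel_two_nilpotent :: "('a, 'b) monoid_scheme \<Rightarrow> 'a set \<Rightarrow> bool" where
  "rel_two_nilpotent G N \<longleftrightarrow>
     (\<exists>K k a. K \<lhd> G \<and> N \<subseteq> K \<and> odd k \<and> card K = card N * k \<and> Coset.order G = card K * 2 ^ a)"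

lemma (in group) p_nilpotent_2I:
  assumes "finite (carrier G)" "K \<lhd> G" "odd (card K)" "Coset.order G = card K * 2 ^ a"
  shows "p_nilpotent 2 G"
proof -
  have "card K \<noteq> 0" using assms(3) by (metis even_zero)
  moreover have "card (rcosets K) * card K = Coset.order G"
    using assms(2) lagrange normal_imp_subgroup by blast
  ultimately have "card (rcosets K) = 2 ^ a" using assms(4) by simp
  with assms show ?thesis unfolding p_nilpotent_def by (metis coprime_right_2_iff_odd)
qed

lemma (in group) p_nilpotent_2_iff:
  assumes "finite (carrier G)"
  shows "p_nilpotent 2 G \<longleftrightarrow> rel_two_nilpotent G {\<one>}"
proof
  assume "p_nilpotent 2 G"
  then obtain K a where K: "K \<lhd> G" "coprime (card K) 2" "card (rcosets K) = 2 ^ a"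
    unfolding p_nilpotent_def by blast
  have sub: "subgroup K G" using K(1) by (rule normal_imp_subgroup)
  have "card (rcosets K) * card K = Coset.order G" using lagrange[OF sub] .
  then have "Coset.order G = card K * 2 ^ a" using K(3) by (simp add: mult.commute)
  with K sub show "rel_two_nilpotent G {\<one>}"
    unfolding rel_two_nilpotent_def
    by (intro exI[of _ K] exI[of _ "card K"] exI[of _ a]) (simp add: subgroup.one_closed)
next
  assume "rel_two_nilpotent G {\<one>}"
  then show "p_nilpotent 2 G"
    unfolding rel_two_nilpotent_def using p_nilpotent_2I[OF assms] by fastforce
qed

text \<open>If \<open>N\<close> has odd order, the preimage \<open>K\<close> of the complement in
  the quotient has odd order as well and is a normal 2-complement of the whole group.\<close>

lemma (in group) rel_two_nilpotent_odd:
  assumes "finite (carrier G)" "rel_two_nilpotent G N" "odd (card N)"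
  shows "p_nilpotent 2 G"
proof -
  obtain K k a where "K \<lhd> G" "odd k" "card K = card N * k" "Coset.order G = card K * 2 ^ a"
    using assms(2) unfolding rel_two_nilpotent_def by blast
  with assms show ?thesis by (intro p_nilpotent_2I[of K a]) simp_all
qed

text \<open>The groups \<open>M\<close>, \<open>K\<close> and \<open>G\<close> all contain the
  kernel, so its order is a factor of each of their orders; cancelling it gives the orders of the
  images.\<close>

lemma (in group_hom) rel_two_nilpotent_image:
  assumes "h ` carrier G = carrier H" "finite (carrier G)" "rel_two_nilpotent G M"
    "subgroup M G" "kernel G H h \<subseteq> M"
  shows "rel_two_nilpotent H (h ` M)"
proof -
  obtain K k a where K: "K \<lhd> G" "M \<subseteq> K" "odd k" "card K = card M * k" "Coset.order G = card K * 2 ^ a"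
    using assms(3) unfolding rel_two_nilpotent_def by blast
  let ?c = "card (kernel G H h)"
  have c: "?c \<noteq> 0" using assms(2) by (rule card_kernel_neq_0)
  have cM: "card M = card (h ` M) * ?c" by (rule card_normal_image) fact+
  have cK: "card K = card (h ` K) * ?c"
    using assms K normal_imp_subgroup by (intro card_normal_image) auto
  have cG: "Coset.order G = Coset.order H * ?c" using assms(1,2) by (rule order_eq_mult_kernel)
  have "card (h ` K) * ?c = card (h ` M) * ?c * k" using K(4) unfolding cM cK .
  then have "card (h ` K) * ?c = card (h ` M) * k * ?c" by (simp only: ac_simps)
  then have "card (h ` K) = card (h ` M) * k" using c by (metis mult_cancel2)
  moreover have "Coset.order H * ?c = card (h ` K) * ?c * 2 ^ a" using K(5) unfolding cG cK .
  then have "Coset.order H * ?c = card (h ` K) * 2 ^ a * ?c" by (simp only: ac_simps)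
  then have "Coset.order H = card (h ` K) * 2 ^ a" using c by (metis mult_cancel2)
  moreover have "h ` K \<lhd> H" using assms(1) K(1) by (rule normal_image)
  ultimately show ?thesis unfolding rel_two_nilpotent_def using K(2,3) by blast
qed

lemma (in group_hom) rel_two_nilpotent_kernel:
  assumes "h ` carrier G = carrier H" "finite (carrier G)" "rel_two_nilpotent H {\<one>\<^bsub>H\<^esub>}"
  shows "rel_two_nilpotent G (Coset.kernel G H h)"
proof -
  obtain K k a where K: "K \<lhd> H" "odd k" "card K = card {\<one>\<^bsub>H\<^esub>} * k" "Coset.order H = card K * 2 ^ a"
    using assms(3) unfolding rel_two_nilpotent_def by blast
  have sub: "subgroup K H" using K(1) by (rule normal_imp_subgroup)
  let ?K = "{g \<in> carrier G. h g \<in> K}"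
  have "card ?K = card (Coset.kernel G H h) * k"
    using card_vimage[OF assms(1,2) subgroup.subset[OF sub]] K(3) by simp
  moreover have "Coset.order G = card ?K * 2 ^ a"
    using order_eq_mult_kernel[OF assms(1,2)] K(4) card_vimage[OF assms(1,2) subgroup.subset[OF sub]]
    by simp
  moreover have "Coset.kernel G H h \<subseteq> ?K" using subgroup.one_closed[OF sub] by (auto simp: kernel_def)
  moreover have "?K \<lhd> G" using K(1) by (rule normal_vimage)
  ultimately show ?thesis unfolding rel_two_nilpotent_def using K(2) by blast
qed

section \<open>Involutions, normalizers and the Frattini argument\<close>

lemma even_card_involution:
  assumes "finite A" and f: "\<And>x. x \<in> A \<Longrightarrow> f x \<in> A" "\<And>x. x \<in> A \<Longrightarrow> f (f x) = x" "\<And>x. x \<in> A \<Longrightarrow> f x \<noteq> x"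
  shows "even (card A)"
proof -
  let ?C = "(\<lambda>x. {x, f x}) ` A"
  have U: "\<Union>?C = A" using f(1) by blast
  have "2 * card ?C = card (\<Union>?C)"
  proof (rule card_partition)
    show "finite ?C" "finite (\<Union>?C)" using assms(1) U by auto
    show "card c = 2" if c: "c \<in> ?C" for c
    proof -
      obtain x where "x \<in> A" "c = {x, f x}" using c by blast
      then show ?thesis using f(3)[of x] by (simp add: card_insert_if eq_commute)
    qed
    show "c1 \<inter> c2 = {}" if c: "c1 \<in> ?C" "c2 \<in> ?C" "c1 \<noteq> c2" for c1 c2
    proof -
      have eq: "c = {z, f z}" if "c \<in> ?C" "z \<in> c" for c z using that f(2) by auto
      have "c1 = c2" if "z \<in> c1" "z \<in> c2" for z
        using eq[OF c(1) that(1)] eq[OF c(2) that(2)] by simp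
      with c(3) show ?thesis by blast
    qed
  qed
  then show ?thesis unfolding U by presburger
qed

text \<open>Membership asks only that conjugation by \<open>g\<close> maps \<open>S\<close> into
  \<open>S\<close>. Closure under inverses requires that it maps \<open>S\<close> onto
  \<open>S\<close>, which follows from injectivity and finiteness.\<close>

lemma (in group) subgroup_normalizing:
  assumes "finite (carrier G)" "subgroup S G"
  shows "subgroup {g \<in> carrier G. \<forall>s\<in>S. g \<otimes> s \<otimes> inv g \<in> S} G" (is "subgroup ?M G")
proof (rule subgroupI)
  interpret S: subgroup S G by fact
  show "?M \<subseteq> carrier G" by blast
  have "\<one> \<in> ?M" by simp
  then show "?M \<noteq> {}" by blast
  fix g assume g: "g \<in> ?M"
  have inj: "inj_on (\<lambda>s. g \<otimes> s \<otimes> inv g) S"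
    using g by (intro inj_onI) (simp add: m_assoc)
  have "(\<lambda>s. g \<otimes> s \<otimes> inv g) ` S = S"
    using g by (intro endo_inj_surj[OF _ _ inj] finite_subset[OF S.subset assms(1)]) blast
  have "inv g \<otimes> s \<otimes> inv (inv g) \<in> S" if "s \<in> S" for s
  proof -
    have "s \<in> (\<lambda>s. g \<otimes> s \<otimes> inv g) ` S" using that \<open>_ ` S = S\<close> by simp
    then obtain s' where s': "s' \<in> S" "s = g \<otimes> s' \<otimes> inv g" by blast
    then have "inv g \<otimes> s \<otimes> g = (inv g \<otimes> g) \<otimes> s' \<otimes> (inv g \<otimes> g)"
      using g by (simp only: m_assoc m_closed inv_closed S.mem_carrier mem_Collect_eq)
    then have "inv g \<otimes> s \<otimes> g = s'" using g s' by simp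
    then show ?thesis using s'(1) g by simp
  qed
  then show "inv g \<in> ?M" using g by simp
  fix h assume h: "h \<in> ?M"
  have "g \<otimes> h \<otimes> s \<otimes> inv (g \<otimes> h) \<in> S" if "s \<in> S" for s
  proof -
    have "g \<otimes> (h \<otimes> s \<otimes> inv h) \<otimes> inv g \<in> S" using g h that by blast
    then show ?thesis using g h that by (simp add: m_assoc inv_mult_group)
  qed
  then show "g \<otimes> h \<in> ?M" using g h by simp
qed

text \<open>The \<open>r\<close>-group \<open>S\<close> acts, through conjugation by \<open>g\<close>, on the cosets of \<open>S\<close> in \<open>R\<close>. Their number is
  the order of \<open>N\<close>, so there is a fixed coset, and it is represented by an element of \<open>N\<close>.\<close>

lemma (in group) frattini:
  assumes fin: "finite (carrier G)" and N: "subgroup N G" and R: "R \<lhd> G" "N \<subseteq> R"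
    and S: "subgroup S G" "S \<subseteq> R" and r: "prime r" "\<not> r dvd card N" "card S = r ^ b"
    and cardR: "card R = card N * card S" and g: "g \<in> carrier G"
  obtains n where "n \<in> N" "\<forall>s\<in>S. (n \<otimes> g) \<otimes> s \<otimes> inv (n \<otimes> g) \<in> S"
proof -
  interpret N: subgroup N G by fact
  interpret R: normal R G by fact
  interpret S: subgroup S G by fact
  have finR: "finite R" "finite N" using fin R.subset N.subset finite_subset by blast+
  let ?E = "(\<lambda>x. S #> x) ` R"
  have E: "?E = rcosets\<^bsub>G\<lparr>carrier := R\<rparr>\<^esub> S" by (auto simp: RCOSETS_def)
  have "card ?E * card S = card R"
    using group.lagrange[OF subgroup_imp_group[OF R.subgroup_axioms], of S] subgroup_incl[OF S(1) R.subgroup_axioms S(2)]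
    unfolding E by (simp add: Coset.order_def)
  then have cardE: "card ?E = card N"
    using cardR r(1,3) prime_gt_0_nat by simp
  \<comment> \<open>\<open>N\<close> meets each coset of \<open>S\<close> at most once, since the
    order of \<open>x \<otimes> inv y\<close> would divide two coprime numbers. Counting then makes
    \<open>N\<close> a full set of representatives.\<close>
  have "inj_on (\<lambda>x. S #> x) N"
  proof (rule inj_onI)
    fix x y assume x: "x \<in> N" and y: "y \<in> N" and eq: "S #> x = S #> y"
    have xy: "x \<in> carrier G" "y \<in> carrier G" using x y by simp_all
    have "x \<in> S #> y" using eq rcos_self[OF xy(1) S(1)] by simp
    then have "x \<otimes> inv y \<in> S" using xy S.rcos_module_imp[OF is_group, of y x] by blast
    moreover have "x \<otimes> inv y \<in> N" using x y by simp
    moreover have "coprime (card S) (card N)"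
      using r prime_imp_coprime_nat[of r "card N"] by simp
    ultimately have "x \<otimes> inv y = \<one>"
      using eq_one_of_coprime_pow[of "x \<otimes> inv y" "card S" "card N"] xy
        pow_card_subgroup[OF fin S(1)] pow_card_subgroup[OF fin N] by simp
    then show "x = y" using xy by (metis inv_equality inv_inv inv_closed)
  qed
  then have "card ((\<lambda>x. S #> x) ` N) = card ?E" using cardE by (simp add: card_image)
  then have EN: "(\<lambda>x. S #> x) ` N = ?E"
    by (intro card_subset_eq finite_imageI finR image_mono R(2))
  interpret SG: group "G\<lparr>carrier := S\<rparr>" using S(1) subgroup_imp_group by blast
  \<comment> \<open>Multiplying cosets on the right reverses products; the inverse of
    \<open>s\<close> turns this into a left action.\<close>
  let ?act = "\<lambda>s X. X #> (g \<otimes> inv s \<otimes> inv g)"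
  have conjR: "g \<otimes> inv s \<otimes> inv g \<in> R" if "s \<in> S" for s
    using that S(2) g by (intro R.inv_op_closed2) auto
  have sub: "X \<subseteq> carrier G" if "X \<in> ?E" for X
    using that r_coset_subset_G[OF S.subset] R.subset by blast
  obtain X where X: "X \<in> ?E" "\<And>s. s \<in> carrier (G\<lparr>carrier := S\<rparr>) \<Longrightarrow> ?act s X = X"
  proof (rule SG.p_group_fixed_point[OF r(1), of b ?E ?act])
    show "Coset.order (G\<lparr>carrier := S\<rparr>) = r ^ b" using r(3) by (simp add: Coset.order_def)
    show "finite ?E" using finR by simp
    show "\<not> r dvd card ?E" using cardE r(2) by simp
    show "?act s X \<in> ?E" if s: "s \<in> carrier (G\<lparr>carrier := S\<rparr>)" and X: "X \<in> ?E" for s X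
    proof -
      obtain x where x: "x \<in> R" "X = S #> x" using X by (rule imageE)
      have "?act s X = S #> (x \<otimes> (g \<otimes> inv s \<otimes> inv g))"
        using x s conjR[of s] by (simp add: coset_mult_assoc[OF S.subset])
      then show ?thesis using x s conjR[of s] by simp
    qed
    show "?act \<one>\<^bsub>G\<lparr>carrier := S\<rparr>\<^esub> X = X" if "X \<in> ?E" for X
      using sub[OF that] g by simp
    show "?act (s \<otimes>\<^bsub>G\<lparr>carrier := S\<rparr>\<^esub> t) X = ?act s (?act t X)"
      if s: "s \<in> carrier (G\<lparr>carrier := S\<rparr>)" and t: "t \<in> carrier (G\<lparr>carrier := S\<rparr>)" and X: "X \<in> ?E" for s t X
    proof -
      have st: "s \<in> carrier G" "t \<in> carrier G" using s t by simp_all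
      have "g \<otimes> inv (s \<otimes> t) \<otimes> inv g = g \<otimes> inv t \<otimes> (inv g \<otimes> g) \<otimes> inv s \<otimes> inv g"
        using st g by (simp add: inv_mult_group m_assoc[symmetric])
      also have "\<dots> = (g \<otimes> inv t \<otimes> inv g) \<otimes> (g \<otimes> inv s \<otimes> inv g)"
        using st g by (simp only: m_assoc m_closed inv_closed)
      finally show ?thesis using st g sub[OF X] by (simp add: coset_mult_assoc)
    qed
  qed blast
  have "X \<in> (\<lambda>x. S #> x) ` N" using X(1) EN by (simp only:)
  then obtain n where n: "n \<in> N" "X = S #> n" by (rule imageE)
  have "(n \<otimes> g) \<otimes> s \<otimes> inv (n \<otimes> g) \<in> S" if s: "s \<in> S" for s
  proof -
    have c: "n \<in> carrier G" "s \<in> carrier G" using n s by simp_all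
    have "S #> n #> (g \<otimes> inv (inv s) \<otimes> inv g) = S #> n"
      using X(2)[of "inv s"] s n by simp
    then have "S #> (n \<otimes> (g \<otimes> s \<otimes> inv g)) = S #> n"
      using c g by (simp add: coset_mult_assoc[OF S.subset])
    then have "n \<otimes> (g \<otimes> s \<otimes> inv g) \<in> S #> n"
      using rcos_self[OF _ S(1), of "n \<otimes> (g \<otimes> s \<otimes> inv g)"] c g by simp
    then have "n \<otimes> (g \<otimes> s \<otimes> inv g) \<otimes> inv n \<in> S"
      by (intro S.rcos_module_imp[OF is_group]) (use c in simp)
    then show ?thesis using c g by (simp add: m_assoc inv_mult_group)
  qed
  with n(1) that show thesis by blast
qed

section \<open>Sign characters of elementary abelian 2-subgroups\<close>

definition sign_homs :: "('a, 'b) monoid_scheme \<Rightarrow> 'a set \<Rightarrow> ('a \<Rightarrow> int) set" where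
  "sign_homs G N = {l \<in> N \<rightarrow>\<^sub>E {1, -1}. \<forall>x\<in>N. \<forall>y\<in>N. l (x \<otimes>\<^bsub>G\<^esub> y) = l x * l y}"

text \<open>A maximal proper subgroup \<open>B\<close> has index 2: for \<open>x\<close> outside
  \<open>B\<close>, the union of \<open>B\<close> and its translate by \<open>x\<close> is a
  subgroup, hence all of \<open>N\<close>. The sign character is 1 on \<open>B\<close> and -1 on the
  translate.\<close>

lemma (in group) ex_nontrivial_sign_hom:
  assumes fin: "finite (carrier G)" and N: "subgroup N G" "N \<noteq> {\<one>}"
    and comm: "\<And>x y. x \<in> N \<Longrightarrow> y \<in> N \<Longrightarrow> x \<otimes> y = y \<otimes> x"
    and sq: "\<And>x. x \<in> N \<Longrightarrow> x \<otimes> x = \<one>"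
  obtains l where "l \<in> sign_homs G N" "l \<noteq> (\<lambda>n\<in>N. 1)"
proof -
  interpret N: subgroup N G by fact
  have finN: "finite N" using fin N.subset finite_subset by blast
  let ?P = "\<lambda>B. subgroup B G \<and> B \<subset> N"
  have "?P {\<one>}" using N(2) N.one_closed triv_subgroup by blast
  moreover have "\<forall>B. ?P B \<longrightarrow> card B < Suc (card N)"
    by (meson card_mono finN le_imp_less_Suc psubset_imp_subset)
  ultimately obtain B where B: "?P B" and max: "\<And>C. ?P C \<Longrightarrow> card C \<le> card B"
    using ex_has_greatest_nat[of ?P "{\<one>}" card "Suc (card N)"] by (metis nat_less_le)
  interpret B: subgroup B G using B by blast
  obtain x where x: "x \<in> N" "x \<notin> B" using B by blast
  have xG: "x \<in> carrier G" using x by simp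
  have BN: "b \<in> N" if "b \<in> B" for b using B that by blast
  let ?C = "B \<union> (\<lambda>b. b \<otimes> x) ` B"
  have swap: "(b \<otimes> x) \<otimes> (c \<otimes> x) = b \<otimes> c" if "b \<in> B" "c \<in> B" for b c
  proof -
    have "(b \<otimes> x) \<otimes> (c \<otimes> x) = b \<otimes> ((x \<otimes> c) \<otimes> x)"
      using that xG by (simp add: m_assoc)
    also have "x \<otimes> c = c \<otimes> x" using comm that x(1) BN by blast
    also have "b \<otimes> ((c \<otimes> x) \<otimes> x) = b \<otimes> c \<otimes> (x \<otimes> x)" using that xG by (simp add: m_assoc)
    finally show ?thesis using sq[OF x(1)] that by simp
  qed
  have CN: "?C \<subseteq> N" using BN x(1) by auto
  have C: "subgroup ?C G"
  proof (rule subgroupI)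
    show "?C \<subseteq> carrier G" using CN N.subset by blast
    show "?C \<noteq> {}" using B.one_closed by blast
    show "inv c \<in> ?C" if "c \<in> ?C" for c
    proof -
      have "c \<in> N" using that CN by blast
      then have "inv c = c" using sq[of c] N.mem_carrier inv_equality by blast
      with that show ?thesis by simp
    qed
    show "c \<otimes> d \<in> ?C" if cd: "c \<in> ?C" "d \<in> ?C" for c d
    proof -
      consider "c \<in> B" "d \<in> B" | b where "c \<in> B" "b \<in> B" "d = b \<otimes> x"
        | b where "b \<in> B" "c = b \<otimes> x" "d \<in> B" | a b where "a \<in> B" "b \<in> B" "c = a \<otimes> x" "d = b \<otimes> x"
        using cd by blast
      then show ?thesis
      proof cases
        case 1 then show ?thesis by simp
      next
        case (2 b)
        then have "c \<otimes> d = (c \<otimes> b) \<otimes> x" using xG by (simp add: m_assoc)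
        with 2 show ?thesis by simp
      next
        case (3 b)
        have "c \<otimes> d = b \<otimes> (x \<otimes> d)" using 3 xG by (simp add: m_assoc)
        also have "x \<otimes> d = d \<otimes> x" using comm 3 x(1) BN by blast
        also have "b \<otimes> (d \<otimes> x) = (b \<otimes> d) \<otimes> x" using 3 xG by (simp add: m_assoc)
        finally show ?thesis using 3 by simp
      next
        case (4 a b)
        then have "c \<otimes> d = a \<otimes> b" using swap by simp
        with 4 show ?thesis by simp
      qed
    qed
  qed
  have "x \<in> ?C" using xG B.one_closed by (force intro: image_eqI[of _ _ \<one>])
  then have "B \<subset> ?C" using x(2) by blast
  then have "card B < card ?C" by (rule psubset_card_mono[OF finite_subset[OF CN finN]])
  then have "?C = N" using max[of ?C] C CN by (meson linorder_not_less psubsetI)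
  then have cases: "n \<in> B \<or> (\<exists>b\<in>B. n = b \<otimes> x)" if "n \<in> N" for n using that by blast
  have nB: "b \<otimes> x \<notin> B" if "b \<in> B" for b
  proof
    assume "b \<otimes> x \<in> B"
    then have "inv b \<otimes> (b \<otimes> x) \<in> B" using that by simp
    then show False using that xG x(2) by (simp add: m_assoc[symmetric])
  qed
  let ?l = "\<lambda>n\<in>N. if n \<in> B then 1 else - 1 :: int"
  have "?l (y \<otimes> z) = ?l y * ?l z" if yz: "y \<in> N" "z \<in> N" for y z
  proof -
    consider "y \<in> B" "z \<in> B" | b where "y \<in> B" "b \<in> B" "z = b \<otimes> x"
      | b where "b \<in> B" "y = b \<otimes> x" "z \<in> B" | a b where "a \<in> B" "b \<in> B" "y = a \<otimes> x" "z = b \<otimes> x"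
      using cases[OF yz(1)] cases[OF yz(2)] by blast
    then show ?thesis
    proof cases
      case 1 then show ?thesis using yz by simp
    next
      case (2 b)
      then have "y \<otimes> z = (y \<otimes> b) \<otimes> x" using xG by (simp add: m_assoc)
      then have "y \<otimes> z \<notin> B" using nB[of "y \<otimes> b"] 2 by simp
      then show ?thesis using 2 yz nB[of b] by simp
    next
      case (3 b)
      have "y \<otimes> z = b \<otimes> (x \<otimes> z)" using 3 xG by (simp add: m_assoc)
      also have "x \<otimes> z = z \<otimes> x" using comm 3 x(1) BN by blast
      also have "b \<otimes> (z \<otimes> x) = (b \<otimes> z) \<otimes> x" using 3 xG by (simp add: m_assoc)
      finally have "y \<otimes> z \<notin> B" using nB[of "b \<otimes> z"] 3 by simp
      then show ?thesis using 3 yz nB[of b] by simp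
    next
      case (4 a b)
      then have "y \<otimes> z \<in> B" using swap by simp
      then show ?thesis using 4 yz nB[of a] nB[of b] by simp
    qed
  qed
  then have "?l \<in> sign_homs G N" by (auto simp: sign_homs_def)
  moreover have "?l \<noteq> (\<lambda>n\<in>N. 1)"
  proof
    assume "?l = (\<lambda>n\<in>N. 1)"
    then have "?l x = (\<lambda>n\<in>N. 1) x" by (rule fun_cong)
    then show False using x by simp
  qed
  ultimately show thesis by (rule that)
qed

text \<open>Pointwise multiplication by \<open>l0\<close> is an involution, because the values are
  signs, and it fixes no \<open>l\<close>, because \<open>l0\<close> takes the value -1
  somewhere.\<close>

lemma (in group) even_card_sign_homs:
  assumes "l0 \<in> sign_homs G N" "l0 \<noteq> (\<lambda>n\<in>N. 1)" "subgroup N G" "finite N"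
  shows "finite (sign_homs G N)" "even (card (sign_homs G N))"
proof -
  interpret N: subgroup N G by fact
  have "sign_homs G N \<subseteq> N \<rightarrow>\<^sub>E {1, -1}" by (auto simp: sign_homs_def)
  then show fin: "finite (sign_homs G N)"
    using finite_PiE[OF assms(4), of "\<lambda>_. {1, -1::int}"] finite_subset by blast
  have l0: "l0 \<in> N \<rightarrow>\<^sub>E {1, -1}" "\<And>x y. x \<in> N \<Longrightarrow> y \<in> N \<Longrightarrow> l0 (x \<otimes> y) = l0 x * l0 y"
    using assms(1) by (auto simp: sign_homs_def)
  then have pm: "l0 n = 1 \<or> l0 n = -1" if "n \<in> N" for n using that by blast
  have ex: "\<exists>n\<in>N. l0 n = -1"
  proof (rule ccontr)
    assume "\<not> ?thesis"
    then have "l0 n = (\<lambda>n\<in>N. 1) n" if "n \<in> N" for n using pm[OF that] that by auto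
    moreover have "l0 \<in> extensional N" using l0(1) by (simp add: PiE_def)
    ultimately have "l0 = (\<lambda>n\<in>N. 1)" by (intro extensionalityI[of _ N]) simp_all
    with assms(2) show False by simp
  qed
  let ?f = "\<lambda>l. \<lambda>n\<in>N. l n * l0 n"
  show "even (card (sign_homs G N))"
  proof (rule even_card_involution[OF fin, of ?f])
    fix l assume l: "l \<in> sign_homs G N"
    then have lE: "l \<in> N \<rightarrow>\<^sub>E {1, -1}" and lm: "\<And>x y. x \<in> N \<Longrightarrow> y \<in> N \<Longrightarrow> l (x \<otimes> y) = l x * l y"
      by (auto simp: sign_homs_def)
    have lpm: "l n = 1 \<or> l n = -1" if "n \<in> N" for n using that lE by blast
    have "?f l \<in> N \<rightarrow>\<^sub>E {1, -1}"
    proof (rule PiE_I)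
      show "?f l n \<in> {1, -1}" if "n \<in> N" for n using that pm[OF that] lpm[OF that] by auto
    qed simp
    then show "?f l \<in> sign_homs G N"
      using lm l0(2) by (simp add: sign_homs_def)
    show "?f (?f l) = l"
    proof
      fix n show "?f (?f l) n = l n"
      proof (cases "n \<in> N")
        case True then show ?thesis using pm[OF True] by auto
      next
        case False then show ?thesis using PiE_arb[OF lE False] by simp
      qed
    qed
    show "?f l \<noteq> l"
    proof
      assume eq: "?f l = l"
      obtain n where n: "n \<in> N" "l0 n = -1" using ex by blast
      have "l n * l0 n = l n" using fun_cong[OF eq, of n] n(1) by simp
      with n lpm[OF n(1)] show False by auto
    qed
  qed
qed

text \<open>There is an even number of sign characters, hence an odd number of nontrivial ones, and one of
  their orbits under \<open>G\<close> has odd length.\<close>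

lemma (in group) ex_sign_hom_odd_stabilizer:
  assumes fin: "finite (carrier G)" and N: "N \<lhd> G" "N \<noteq> {\<one>}"
    and comm: "\<And>x y. x \<in> N \<Longrightarrow> y \<in> N \<Longrightarrow> x \<otimes> y = y \<otimes> x"
    and sq: "\<And>x. x \<in> N \<Longrightarrow> x \<otimes> x = \<one>"
  obtains l T where "l \<in> sign_homs G N" "\<exists>n\<in>N. l n \<noteq> 1" "subgroup T G" "odd (card (rcosets T))"
    "T = {g \<in> carrier G. \<forall>n\<in>N. l (inv g \<otimes> n \<otimes> g) = l n}"
proof -
  interpret N: normal N G by fact
  have finN: "finite N" using fin N.subset finite_subset by blast
  have cN: "inv g \<otimes> n \<otimes> g \<in> N" if "g \<in> carrier G" "n \<in> N" for g n
    using that N.inv_op_closed1 by blast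
  obtain l0 where l0: "l0 \<in> sign_homs G N" "l0 \<noteq> (\<lambda>n\<in>N. 1)"
    using ex_nontrivial_sign_hom[OF fin N.subgroup_axioms N(2) comm sq] by blast
  note even = even_card_sign_homs[OF l0 N.subgroup_axioms finN]
  let ?E = "sign_homs G N - {\<lambda>n\<in>N. 1}"
  have triv: "(\<lambda>n\<in>N. 1) \<in> sign_homs G N" by (auto simp: sign_homs_def)
  have "card (sign_homs G N) = Suc (card ?E)"
    using card.remove[OF even(1) triv] .
  then have oddE: "\<not> 2 dvd card ?E" using even(2) by simp
  let ?act = "\<lambda>g l. \<lambda>n\<in>N. l (inv g \<otimes> n \<otimes> g)"
  have act_mult: "?act (g \<otimes> h) l = ?act g (?act h l)" if "g \<in> carrier G" "h \<in> carrier G" for g h l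
    using that cN by (intro restrict_ext) (simp add: inv_mult_group m_assoc)
  have act_one: "?act \<one> l = l" if "l \<in> sign_homs G N" for l
  proof
    fix n show "?act \<one> l n = l n"
      using that by (cases "n \<in> N") (auto simp: sign_homs_def PiE_def extensional_def)
  qed
  have act_closed: "?act g l \<in> sign_homs G N" if g: "g \<in> carrier G" and l: "l \<in> sign_homs G N" for g l
  proof -
    have lE: "l \<in> N \<rightarrow>\<^sub>E {1, -1}" and lm: "\<And>x y. x \<in> N \<Longrightarrow> y \<in> N \<Longrightarrow> l (x \<otimes> y) = l x * l y"
      using l by (auto simp: sign_homs_def)
    have "?act g l (x \<otimes> y) = ?act g l x * ?act g l y" if "x \<in> N" "y \<in> N" for x y
    proof -
      have "inv g \<otimes> (x \<otimes> y) \<otimes> g = (inv g \<otimes> x) \<otimes> (g \<otimes> inv g) \<otimes> y \<otimes> g"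
        using g that by (simp add: m_assoc)
      also have "\<dots> = (inv g \<otimes> x \<otimes> g) \<otimes> (inv g \<otimes> y \<otimes> g)"
        using g that by (simp only: m_assoc m_closed inv_closed N.mem_carrier)
      finally show ?thesis using that lm cN[OF g] by simp
    qed
    moreover have "?act g l \<in> N \<rightarrow>\<^sub>E {1, -1}"
    proof (rule PiE_I)
      fix n assume n: "n \<in> N"
      have "l (inv g \<otimes> n \<otimes> g) \<in> {1, -1}" using lE cN[OF g n] by (rule PiE_mem)
      then show "?act g l n \<in> {1, -1}" using n by simp
    qed simp
    ultimately show ?thesis by (simp add: sign_homs_def)
  qed
  have act_E: "?act g l \<in> ?E" if g: "g \<in> carrier G" and l: "l \<in> ?E" for g l
  proof -
    have "?act g l \<noteq> (\<lambda>n\<in>N. 1)"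
    proof
      assume eq: "?act g l = (\<lambda>n\<in>N. 1)"
      have "l = ?act (inv g \<otimes> g) l" using act_one l g by simp
      also have "\<dots> = ?act (inv g) (\<lambda>n\<in>N. 1)" using act_mult[of "inv g" g l] g eq by simp
      also have "\<dots> = (\<lambda>n\<in>N. 1)" using cN[of "inv g"] g by (intro restrict_ext) simp
      finally show False using l by blast
    qed
    with act_closed[OF g] l show ?thesis by blast
  qed
  obtain l where l: "l \<in> ?E" "subgroup {g \<in> carrier G. ?act g l = l} G"
    "\<not> 2 dvd card (rcosets {g \<in> carrier G. ?act g l = l})"
  proof (rule ex_stabilizer_index_not_dvd[OF fin, of ?E ?act 2])
    show "finite ?E" using even(1) by simp
    show "?act \<one> l = l" if "l \<in> ?E" for l using act_one that by blast
  qed (use act_E act_mult oddE in \<open>blast+\<close>)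
  have lext: "l \<in> extensional N" using l(1) by (auto simp: sign_homs_def PiE_def)
  have T: "{g \<in> carrier G. ?act g l = l} = {g \<in> carrier G. \<forall>n\<in>N. l (inv g \<otimes> n \<otimes> g) = l n}"
  proof (intro Collect_cong conj_cong refl iffI ballI)
    fix g n assume "?act g l = l" "n \<in> N"
    then show "l (inv g \<otimes> n \<otimes> g) = l n" by (metis restrict_apply')
  next
    fix g assume "\<forall>n\<in>N. l (inv g \<otimes> n \<otimes> g) = l n"
    then show "?act g l = l" by (intro extensionalityI[OF _ lext]) simp_all
  qed
  have "\<exists>n\<in>N. l n \<noteq> 1"
  proof (rule ccontr)
    assume "\<not> ?thesis"
    then have "l = (\<lambda>n\<in>N. 1)" by (intro extensionalityI[OF lext]) simp_all
    with l(1) show False by blast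
  qed
  with that[of l "{g \<in> carrier G. ?act g l = l}"] l T show thesis by blast
qed

section \<open>Monomial data in solvable groups that are not 2-nilpotent\<close>

text \<open>The character of \<open>G\<close> induced from the sign character \<open>l\<close> of \<open>T\<close> has odd degree greater than 1.
  The last condition, a strong form of Mackey's criterion, says that the conjugates of \<open>l\<close>
  by different cosets of \<open>T\<close> already differ on \<open>N\<close>.\<close>

definition odd_monomial :: "('a, 'b) monoid_scheme \<Rightarrow> 'a set \<Rightarrow> 'a set \<Rightarrow> ('a \<Rightarrow> int) \<Rightarrow> bool" where
  "odd_monomial G N T l \<longleftrightarrow>
     N \<lhd> G \<and> N \<subseteq> T \<and> subgroup T G \<and> T \<noteq> carrier G \<and> odd (card (rcosets\<^bsub>G\<^esub> T)) \<and>
     (\<forall>t\<in>T. l t = 1 \<or> l t = -1) \<and>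
     (\<forall>s\<in>T. \<forall>t\<in>T. l (s \<otimes>\<^bsub>G\<^esub> t) = l s * l t) \<and>
     (\<forall>g\<in>carrier G - T. \<exists>n\<in>N. l (inv\<^bsub>G\<^esub> g \<otimes>\<^bsub>G\<^esub> n \<otimes>\<^bsub>G\<^esub> g) \<noteq> l n)"

text \<open>Every \<open>g\<close> factors uniquely as \<open>p g\<close> in \<open>N\<close> times
  an element of \<open>M\<close>, and the extension of \<open>l\<close> ignores the second factor.
  It is multiplicative on \<open>T\<close> because there the factor from \<open>M\<close> also lies
  in the stabilizer of \<open>l\<close>.\<close>

lemma (in group) odd_monomial_of_complement:
  assumes N: "N \<lhd> G" and M: "subgroup M G" "N \<inter> M = {\<one>}"
    and NM: "\<And>g. g \<in> carrier G \<Longrightarrow> \<exists>n\<in>N. inv n \<otimes> g \<in> M"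
    and comm: "\<And>x y. x \<in> N \<Longrightarrow> y \<in> N \<Longrightarrow> x \<otimes> y = y \<otimes> x"
    and l: "l \<in> sign_homs G N" and T: "subgroup T G" "odd (card (rcosets T))" "T \<noteq> carrier G"
      "T = {g \<in> carrier G. \<forall>n\<in>N. l (inv g \<otimes> n \<otimes> g) = l n}"
  obtains l' where "odd_monomial G N T l'"
proof -
  interpret N: normal N G by fact
  interpret M: subgroup M G by fact
  interpret T: subgroup T G by fact
  have lE: "l \<in> N \<rightarrow>\<^sub>E {1, -1}" and lm: "\<And>x y. x \<in> N \<Longrightarrow> y \<in> N \<Longrightarrow> l (x \<otimes> y) = l x * l y"
    using l by (auto simp: sign_homs_def)
  have unique: "m = n" if "m \<in> N" "n \<in> N" "inv m \<otimes> g \<in> M" "inv n \<otimes> g \<in> M" "g \<in> carrier G" for m n g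
  proof -
    have "(inv m \<otimes> g) \<otimes> inv (inv n \<otimes> g) \<in> M" using that(3,4) by (rule M.m_closed[OF _ M.m_inv_closed])
    moreover have "(inv m \<otimes> g) \<otimes> inv (inv n \<otimes> g) = inv m \<otimes> n"
      using that(1,2,5) by (simp add: inv_mult_group m_assoc inv_mult_cancel)
    ultimately have "inv m \<otimes> n \<in> N \<inter> M" using that(1,2) by simp
    then have "inv m \<otimes> n = \<one>" using M(2) by simp
    then show ?thesis using that(1,2) by (metis N.mem_carrier inv_closed inv_equality inv_inv)
  qed
  define p where "p = (\<lambda>g. SOME n. n \<in> N \<and> inv n \<otimes> g \<in> M)"
  have p: "p g \<in> N" "inv (p g) \<otimes> g \<in> M" if "g \<in> carrier G" for g
  proof -
    have "\<exists>n. n \<in> N \<and> inv n \<otimes> g \<in> M" using NM[OF that] by blast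
    from someI_ex[OF this] show "p g \<in> N" "inv (p g) \<otimes> g \<in> M" unfolding p_def by blast+
  qed
  have pN: "p n = n" if "n \<in> N" for n
    using unique[of "p n" n n] p[of n] that M.one_closed by simp
  let ?l = "\<lambda>g. l (p g)"
  have NT: "N \<subseteq> T"
  proof
    fix g assume g: "g \<in> N"
    have "l (inv g \<otimes> n \<otimes> g) = l n" if "n \<in> N" for n
    proof -
      have "inv g \<otimes> n \<otimes> g = inv g \<otimes> (g \<otimes> n)" using that g comm[of n g] by (simp add: m_assoc)
      also have "\<dots> = n" using that g by (simp add: m_assoc[symmetric])
      finally show ?thesis by simp
    qed
    then show "g \<in> T" using g unfolding T(4) by simp
  qed
  have mult: "?l (s \<otimes> t) = ?l s * ?l t" if s: "s \<in> T" and t: "t \<in> T" for s t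
  proof -
    have sG: "s \<in> carrier G" and tG: "t \<in> carrier G" using s t by simp_all
    define n n' m m' where "n = p s" and "n' = p t" and "m = inv n \<otimes> s" and "m' = inv n' \<otimes> t"
    note defs = this
    have m: "m \<in> M" "m' \<in> M" using p sG tG by (simp_all add: defs)
    have n: "n \<in> N" "n' \<in> N" using p sG tG by (simp_all add: defs)
    have cG: "n \<in> carrier G" "n' \<in> carrier G" "m \<in> carrier G" "m' \<in> carrier G" using m n by simp_all
    have "n \<in> T" using n NT by blast
    then have mT: "m \<in> T" using s by (simp add: defs(3))
    \<comment> \<open>Moving \<open>m\<close> past \<open>n'\<close> replaces \<open>n'\<close> by
      this conjugate, on which \<open>l\<close> takes the same value because \<open>m\<close> lies
      in \<open>T\<close>.\<close>
    let ?c = "m \<otimes> n' \<otimes> inv m"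
    have c: "?c \<in> N" using N.inv_op_closed2[OF cG(3) n(2)] .
    have "inv m \<in> T" using mT by simp
    then have "l (inv (inv m) \<otimes> n' \<otimes> inv m) = l n'" using n(2) unfolding T(4) by blast
    then have lc: "l ?c = l n'" using cG by simp
    have st: "s = n \<otimes> m" "t = n' \<otimes> m'"
      using cG(1,2) sG tG by (simp_all add: defs(3,4) inv_mult_cancel)
    have "inv (n \<otimes> ?c) \<otimes> (s \<otimes> t) = m \<otimes> m'"
      unfolding st using cG by (simp add: inv_mult_group m_assoc inv_mult_cancel)
    then have "inv (n \<otimes> ?c) \<otimes> (s \<otimes> t) \<in> M" using m by simp
    then have "p (s \<otimes> t) = n \<otimes> ?c"
      by (intro unique[OF p(1) _ p(2)]) (use sG tG n c in simp_all)
    then have "?l (s \<otimes> t) = l n * l n'" using lm[OF n(1) c] lc by simp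
    then show ?thesis by (simp add: defs(1,2))
  qed
  have "odd_monomial G N T ?l"
    unfolding odd_monomial_def
  proof (intro conjI ballI)
    show "?l t = 1 \<or> ?l t = -1" if "t \<in> T" for t
      using PiE_mem[OF lE p(1)[of t]] that by simp
    show "\<exists>n\<in>N. ?l (inv g \<otimes> n \<otimes> g) \<noteq> ?l n" if g: "g \<in> carrier G - T" for g
    proof -
      obtain n where n: "n \<in> N" "l (inv g \<otimes> n \<otimes> g) \<noteq> l n" using g unfolding T(4) by blast
      have "inv g \<otimes> n \<otimes> g \<in> N" using n(1) g by (intro N.inv_op_closed1) auto
      then show ?thesis using n pN by (intro bexI[of _ n]) simp_all
    qed
  qed (rule N NT T mult | assumption)+
  then show thesis by (rule that)
qed

text \<open>By \<open>rel\<close> all proper quotients are 2-nilpotent, so a nontrivial normal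
  subgroup of odd order would make \<open>G\<close> 2-nilpotent. This is used twice:
  \<open>N\<close> has even order, and \<open>S\<close> is not normal.\<close>

lemma (in group) ex_odd_monomial_of_minimal:
  assumes fin: "finite (carrier G)" and solv: "solvable G" and not: "\<not> p_nilpotent 2 G"
    and rel: "\<And>N. N \<lhd> G \<Longrightarrow> N \<noteq> {\<one>} \<Longrightarrow> rel_two_nilpotent G N"
  obtains N T l where "odd_monomial G N T l"
proof -
  have nt: "carrier G \<noteq> {\<one>}"
  proof
    assume "carrier G = {\<one>}"
    then have "p_nilpotent 2 G"
      using one_is_normal p_nilpotent_2I[OF fin, of "carrier G" 0] by (simp add: Coset.order_def)
    with not show False by simp
  qed
  obtain N where N1: "N \<lhd> G" "N \<subseteq> carrier G" "N \<noteq> {\<one>}" and minN: "\<And>L. L \<lhd> G \<Longrightarrow> L \<subseteq> N \<Longrightarrow> L = {\<one>} \<or> L = N"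
    by (rule ex_minimal_normal[OF fin normal_self nt]) (rule that)
  note N = N1(1,3)
  interpret N: normal N G by fact
  note comm = minimal_normal_commute[OF solv N minN]
  obtain p :: nat where p: "prime p" "\<forall>x\<in>N. x [^] p = \<one>"
    using minimal_normal_exponent[OF fin N minN comm] by blast
  obtain b where b: "card N = p ^ b" using prime_power_card[OF fin N.subgroup_axioms p] by blast
  have evenN: "even (card N)" using rel_two_nilpotent_odd[OF fin rel[OF N]] not by blast
  then have p2: "p = 2" unfolding b
    using p(1) by (metis even_power prime_odd_nat prime_ge_2_nat le_neq_implies_less)
  have sq: "x \<otimes> x = \<one>" if "x \<in> N" for x
    using p(2) that N.mem_carrier[OF that] unfolding p2 by (simp add: numeral_2_eq_2)
  obtain K k a where K: "K \<lhd> G" "N \<subseteq> K" "odd k" "card K = card N * k" "Coset.order G = card K * 2 ^ a"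
    using rel[OF N] unfolding rel_two_nilpotent_def by blast
  interpret K: normal K G by fact
  have finK: "finite K" using fin K.subset finite_subset by blast
  \<comment> \<open>Otherwise \<open>G\<close> would be a 2-group, with the trivial subgroup as its
    2-complement.\<close>
  have "K \<noteq> N"
  proof
    assume "K = N"
    then have "Coset.order G = card {\<one>} * 2 ^ (b + a)" using K(5) b p2 by (simp add: power_add)
    then have "p_nilpotent 2 G" by (intro p_nilpotent_2I[OF fin one_is_normal]) simp_all
    with not show False by simp
  qed

  let ?Q = "G Mod N" and ?h = "\<lambda>x. N #> x"
  interpret Q: group ?Q by (rule N.factorgroup_is_group)
  interpret h: group_hom G ?Q ?h
    using N.r_coset_hom_Mod by (simp add: group_hom_def group_hom_axioms_def is_group Q.is_group)
  have surj: "?h ` carrier G = carrier ?Q" by (simp add: carrier_FactGroup)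
  have ker: "Coset.kernel G ?Q ?h = N" by (rule N.kernel_r_coset)
  have finQ: "finite (carrier ?Q)" unfolding surj[symmetric] using fin by simp
  have solvQ: "solvable ?Q" using h.surj_hom_imp_solvable[OF surj solv] .
  have cardN: "card N \<noteq> 0" using fin N.subset N.one_closed finite_subset by (metis card_0_eq empty_iff)
  have cardhK: "card (?h ` K) = k"
    using h.card_normal_image[OF surj fin K.subgroup_axioms] K(2,4) cardN unfolding ker by simp
  have hK1: "?h ` K \<noteq> {\<one>\<^bsub>?Q\<^esub>}"
  proof
    assume "?h ` K = {\<one>\<^bsub>?Q\<^esub>}"
    then have "card K = card N" using cardhK K(4) by simp
    then have "K = N" using card_subset_eq[OF finK K(2)] by simp
    with \<open>K \<noteq> N\<close> show False by simp
  qed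
  have hK: "?h ` K \<lhd> ?Q" using surj K(1) by (rule h.normal_image)
  obtain R' where R': "R' \<lhd> ?Q" "R' \<subseteq> ?h ` K" "R' \<noteq> {\<one>\<^bsub>?Q\<^esub>}"
      and minR: "\<And>L. L \<lhd> ?Q \<Longrightarrow> L \<subseteq> R' \<Longrightarrow> L = {\<one>\<^bsub>?Q\<^esub>} \<or> L = R'"
    by (rule Q.ex_minimal_normal[OF finQ hK hK1]) (rule that)
  interpret R': normal R' ?Q by fact
  obtain r :: nat where r: "prime r" "\<forall>x\<in>R'. x [^]\<^bsub>?Q\<^esub> r = \<one>\<^bsub>?Q\<^esub>"
    using Q.minimal_normal_exponent[OF finQ R'(1,3) minR Q.minimal_normal_commute[OF solvQ R'(1,3) minR]]
    by blast
  obtain c where c: "card R' = r ^ c"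
    using Q.prime_power_card[OF finQ R'.subgroup_axioms r] by blast
  obtain y where y: "y \<in> R'" "y \<noteq> \<one>\<^bsub>?Q\<^esub>" using R'(3) R'.one_closed by blast
  \<comment> \<open>The chief factor \<open>R'\<close> was chosen inside the image of
    \<open>K\<close>, whose order \<open>k\<close> is odd; the order of \<open>y\<close> would
    divide both 2 and \<open>k\<close>.\<close>
  have "r \<noteq> 2"
  proof
    assume "r = 2"
    then have "coprime r k" using K(3) by simp
    moreover have "y [^]\<^bsub>?Q\<^esub> k = \<one>\<^bsub>?Q\<^esub>"
      using Q.pow_card_subgroup[OF finQ normal_imp_subgroup[OF hK], of y] y(1) R'(2) unfolding cardhK by blast
    ultimately show False using Q.eq_one_of_coprime_pow[of y r k] r(2) y by simp
  qed
  then have oddr: "odd r" using r(1) by (metis prime_odd_nat prime_ge_2_nat le_neq_implies_less)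
  have c0: "c \<noteq> 0"
  proof
    assume "c = 0"
    then have "card R' = 1" using c by simp
    then show False using y R'.one_closed by (metis card_1_singletonE singletonD)
  qed

  define R where "R = {g \<in> carrier G. ?h g \<in> R'}"
  have R: "R \<lhd> G" unfolding R_def using R'(1) by (rule h.normal_vimage)
  interpret R: normal R G by fact
  have cardR: "card R = card N * r ^ c"
    using h.card_vimage[OF surj fin R'.subset] unfolding R_def ker c by simp
  have NR: "N \<subseteq> R"
  proof
    fix n assume n: "n \<in> N"
    have nG: "n \<in> carrier G" using N.mem_carrier[OF n] .
    have "?h n = \<one>\<^bsub>?Q\<^esub>" using coset_join2[OF nG N.subgroup_axioms n] by simp
    then have "?h n \<in> R'" using R'.one_closed by (simp only:)
    with nG show "n \<in> R" unfolding R_def by (intro CollectI conjI)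
  qed
  have finR: "finite R" using fin R.subset finite_subset by blast
  obtain S where S: "subgroup S (G\<lparr>carrier := R\<rparr>)" "card S = r ^ c"
    using sylow_thm[OF r(1) subgroup_imp_group[OF R.subgroup_axioms], of c "card N"] cardR finR
    by (auto simp: Coset.order_def)
  have SR: "S \<subseteq> R" using subgroup.subset[OF S(1)] by simp
  have SG: "subgroup S G" using incl_subgroup[OF R.subgroup_axioms S(1)] .
  have rN: "\<not> r dvd card N"
  proof
    assume "r dvd card N"
    then have "r dvd 2" unfolding b p2 using r(1) prime_dvd_power by blast
    then show False using r(1) oddr by (metis primes_dvd_imp_eq two_is_prime_nat dvd_refl)
  qed
  define M where "M = {g \<in> carrier G. \<forall>s\<in>S. g \<otimes> s \<otimes> inv g \<in> S}"
  have M: "subgroup M G" unfolding M_def using fin SG by (rule subgroup_normalizing)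
  interpret M: subgroup M G by fact
  have NM: "\<exists>n\<in>N. inv n \<otimes> g \<in> M" if g: "g \<in> carrier G" for g
  proof -
    have cardRS: "card R = card N * card S" using cardR S(2) by simp
    obtain n where n: "n \<in> N" "\<forall>s\<in>S. (n \<otimes> g) \<otimes> s \<otimes> inv (n \<otimes> g) \<in> S"
      by (rule frattini[OF fin N.subgroup_axioms R NR SG SR r(1) rN S(2) cardRS g])
    have "n \<otimes> g \<in> carrier G" using N.mem_carrier[OF n(1)] g by simp
    then have "n \<otimes> g \<in> M" using n(2) unfolding M_def by (intro CollectI conjI)
    then show ?thesis using n(1) by (intro bexI[of _ "inv n"]) simp_all
  qed
  have MG: "M \<noteq> carrier G"
  proof
    assume "M = carrier G"
    then have "\<forall>g\<in>carrier G. \<forall>s\<in>S. g \<otimes> s \<otimes> inv g \<in> S" unfolding M_def by blast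
    then have "S \<lhd> G" using SG unfolding normal_inv_iff by blast
    moreover have "card S \<noteq> 1" using S(2) c0 prime_gt_1_nat[OF r(1)] by simp
    then have "S \<noteq> {\<one>}" by auto
    ultimately have "p_nilpotent 2 G"
      using rel_two_nilpotent_odd[OF fin rel, of S] S(2) oddr by simp
    with not show False by simp
  qed
  have NnM: "\<not> N \<subseteq> M"
  proof
    assume NsM: "N \<subseteq> M"
    have "g \<in> M" if g: "g \<in> carrier G" for g
    proof -
      obtain n where n: "n \<in> N" "inv n \<otimes> g \<in> M" using NM[OF g] by blast
      then have "n \<otimes> (inv n \<otimes> g) \<in> M" using NsM by blast
      then show ?thesis using n(1) g by (simp add: m_assoc[symmetric])
    qed
    with MG M.subset show False by blast
  qed
  \<comment> \<open>With \<open>g\<close> written as \<open>n\<close> times \<open>?m\<close>, the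
    factor \<open>?m\<close> normalizes both \<open>N\<close> and \<open>M\<close>, and
    \<open>n\<close> centralizes \<open>N\<close>.\<close>
  have "N \<inter> M \<lhd> G"
    unfolding normal_inv_iff
  proof (intro conjI ballI)
    show "subgroup (N \<inter> M) G" using N.subgroup_axioms M by (rule subgroups_Inter_pair)
    fix g x assume g: "g \<in> carrier G" and x: "x \<in> N \<inter> M"
    obtain n where n: "n \<in> N" "inv n \<otimes> g \<in> M" using NM[OF g] by blast
    let ?m = "inv n \<otimes> g"
    have cG: "n \<in> carrier G" "x \<in> carrier G" "?m \<in> carrier G" using n x g by simp_all
    have y: "?m \<otimes> x \<otimes> inv ?m \<in> N" using N.inv_op_closed2[OF cG(3)] x by blast
    have "g \<otimes> x \<otimes> inv g = n \<otimes> (?m \<otimes> x \<otimes> inv ?m) \<otimes> inv n"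
    proof -
      have "g = n \<otimes> ?m" using cG(1) g by (simp add: m_assoc[symmetric])
      then have "g \<otimes> x \<otimes> inv g = n \<otimes> ?m \<otimes> x \<otimes> inv (n \<otimes> ?m)" by simp
      also have "\<dots> = n \<otimes> ?m \<otimes> x \<otimes> (inv ?m \<otimes> inv n)" using cG by (simp only: inv_mult_group)
      finally show ?thesis using cG by (simp only: m_assoc m_closed inv_closed)
    qed
    also have "n \<otimes> (?m \<otimes> x \<otimes> inv ?m) = (?m \<otimes> x \<otimes> inv ?m) \<otimes> n" using comm n(1) y by blast
    also have "\<dots> \<otimes> inv n = ?m \<otimes> x \<otimes> inv ?m" using cG by (simp only: m_assoc m_closed inv_closed r_inv r_one)
    finally have eq: "g \<otimes> x \<otimes> inv g = ?m \<otimes> x \<otimes> inv ?m" .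
    have "?m \<otimes> x \<otimes> inv ?m \<in> M" using n(2) x by blast
    with y show "g \<otimes> x \<otimes> inv g \<in> N \<inter> M" unfolding eq by blast
  qed
  then have NM1: "N \<inter> M = {\<one>}" using minN[of "N \<inter> M"] NnM by blast

  obtain l T where l: "l \<in> sign_homs G N" "\<exists>n\<in>N. l n \<noteq> 1" and T: "subgroup T G" "odd (card (rcosets T))"
    "T = {g \<in> carrier G. \<forall>n\<in>N. l (inv g \<otimes> n \<otimes> g) = l n}"
    using ex_sign_hom_odd_stabilizer[OF fin N comm sq] by blast
  have lE: "l \<in> N \<rightarrow>\<^sub>E {1, -1}" and lm: "\<And>x y. x \<in> N \<Longrightarrow> y \<in> N \<Longrightarrow> l (x \<otimes> y) = l x * l y"
    using l(1) by (auto simp: sign_homs_def)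
  \<comment> \<open>If \<open>l\<close> were invariant under \<open>G\<close>, its kernel
    \<open>?L\<close> would be normal, hence trivial by minimality. The product of a conjugate of
    \<open>n\<close> with \<open>n\<close> lies in \<open>?L\<close>, because \<open>l\<close> takes
    the same sign on both. So every \<open>s\<close> in \<open>S\<close> commutes with every
    \<open>n\<close>, and \<open>N\<close> would lie in \<open>M\<close>.\<close>
  have TG: "T \<noteq> carrier G"
  proof
    assume TG: "T = carrier G"
    have inv: "l (inv g \<otimes> n \<otimes> g) = l n" if "g \<in> carrier G" "n \<in> N" for g n
    proof -
      have "g \<in> T" using that TG by simp
      then show ?thesis using that(2) unfolding T(3) by blast
    qed
    have lpm: "l n = 1 \<or> l n = -1" if "n \<in> N" for n using PiE_mem[OF lE that] by simp
    have invN: "inv n = n" if "n \<in> N" for n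
      using sq[OF that] N.mem_carrier[OF that] by (simp add: inv_equality)
    let ?L = "{n \<in> N. l n = 1}"
    have l1: "l \<one> = 1" using lm[of \<one> \<one>] lpm[of \<one>] N.one_closed by auto
    have "?L \<lhd> G"
      unfolding normal_inv_iff
    proof (intro conjI ballI)
      show "subgroup ?L G"
      proof (rule subgroupI)
        show "?L \<noteq> {}" using l1 N.one_closed by blast
      qed (use lm N.subset invN in auto)
      fix g n assume "g \<in> carrier G" "n \<in> ?L"
      then show "g \<otimes> n \<otimes> inv g \<in> ?L"
        using inv[of "inv g" n] N.inv_op_closed2[of g n] by simp
    qed
    then have L1: "?L = {\<one>}" using minN[of ?L] l(2) by blast
    have "n \<in> M" if n: "n \<in> N" for n
    proof -
      have conj: "n \<otimes> s \<otimes> inv n \<in> S" if s: "s \<in> S" for s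
      proof -
        have cG: "n \<in> carrier G" "s \<in> carrier G" using n s SG subgroup.mem_carrier by auto
        let ?u = "inv s \<otimes> n \<otimes> s"
        have u: "?u \<in> N" using N.inv_op_closed1[OF cG(2) n] .
        have "l (?u \<otimes> n) = 1" using lm[OF u n] inv[OF cG(2) n] lpm[OF n] by auto
        then have "?u \<otimes> n \<in> ?L" using u n by simp
        then have "?u \<otimes> n = \<one>" unfolding L1 by simp
        then have "?u = n" using invN[OF n] cG u by (metis inv_equality inv_inv N.mem_carrier)
        then have "s \<otimes> ?u = s \<otimes> n" by simp
        then have "n \<otimes> s = s \<otimes> n" using cG by (simp add: m_assoc[symmetric])
        then have "n \<otimes> s \<otimes> inv n = s" using cG by (simp add: m_assoc)
        then show ?thesis using s by simp
      qed
      show ?thesis unfolding M_def by (intro CollectI conjI ballI conj N.mem_carrier[OF n])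
    qed
    with NnM show False by blast
  qed
  show thesis
    by (rule odd_monomial_of_complement[OF N(1) M NM1 NM comm l(1) T(1,2) TG T(3)]) (use that in blast)+
qed

text \<open>Transporting the data from a quotient back to \<open>G\<close> means that only
  \<open>G\<close> itself has to carry an induced representation. The index of \<open>T\<close> is
  unchanged because the orders of \<open>T\<close> and of the group grow by the same factor, the
  order of the kernel.\<close>

lemma (in group_hom) odd_monomial_vimage:
  assumes surj: "h ` carrier G = carrier H" and fin: "finite (carrier G)" and om: "odd_monomial H N T l"
  shows "odd_monomial G {g \<in> carrier G. h g \<in> N} {g \<in> carrier G. h g \<in> T} (\<lambda>g. l (h g))"
proof -
  let ?T = "{g \<in> carrier G. h g \<in> T}"
  have T: "N \<lhd> H" "N \<subseteq> T" "subgroup T H" "T \<noteq> carrier H" "odd (card (rcosets\<^bsub>H\<^esub> T))"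
    "\<And>t. t \<in> T \<Longrightarrow> l t = 1 \<or> l t = -1"
    "\<And>s t. s \<in> T \<Longrightarrow> t \<in> T \<Longrightarrow> l (s \<otimes>\<^bsub>H\<^esub> t) = l s * l t"
    "\<And>x. x \<in> carrier H - T \<Longrightarrow> \<exists>n\<in>N. l (inv\<^bsub>H\<^esub> x \<otimes>\<^bsub>H\<^esub> n \<otimes>\<^bsub>H\<^esub> x) \<noteq> l n"
    using om unfolding odd_monomial_def by blast+
  interpret T: subgroup T H by (rule T(3))
  have subT: "subgroup ?T G" using T(3) by (rule subgroup_vimage)
  let ?c = "card (Coset.kernel G H h)"
  have finH: "finite (carrier H)" unfolding surj[symmetric] using fin by simp
  have "card T \<noteq> 0" using finH T.subset T.one_closed finite_subset by (metis card_0_eq empty_iff)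
  have cT: "card ?T = card T * ?c" using card_vimage[OF surj fin T.subset] .
  have "card (rcosets ?T) * (card T * ?c) = Coset.order G"
    using G.lagrange[OF subT] unfolding cT .
  also have "\<dots> = card (rcosets\<^bsub>H\<^esub> T) * (card T * ?c)"
    using H.lagrange[OF T(3)] order_eq_mult_kernel[OF surj fin] by (simp add: mult.assoc[symmetric])
  finally have eq: "card (rcosets ?T) * (card T * ?c) = card (rcosets\<^bsub>H\<^esub> T) * (card T * ?c)" .
  have "card T * ?c \<noteq> 0" by (rule no_zero_divisors[OF \<open>card T \<noteq> 0\<close> card_kernel_neq_0[OF fin]])
  from iffD1[OF mult_right_cancel[OF this] eq] have cosets: "card (rcosets ?T) = card (rcosets\<^bsub>H\<^esub> T)" .
  have odd: "odd (card (rcosets ?T))" unfolding cosets by (rule T(5))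
  have proper: "?T \<noteq> carrier G"
  proof
    assume eq: "?T = carrier G"
    have "x \<in> T" if "x \<in> carrier H" for x
    proof -
      have "x \<in> h ` carrier G" using that unfolding surj .
      then obtain g where "g \<in> ?T" "x = h g" unfolding eq by (rule imageE)
      then show ?thesis by simp
    qed
    with T(4) T.subset show False by blast
  qed
  show ?thesis
    unfolding odd_monomial_def
  proof (intro conjI ballI)
    show "{g \<in> carrier G. h g \<in> N} \<lhd> G" using T(1) by (rule normal_vimage)
    show "{g \<in> carrier G. h g \<in> N} \<subseteq> ?T" using T(2) by blast
    show "l (h t) = 1 \<or> l (h t) = -1" if "t \<in> ?T" for t using T(6)[of "h t"] that by simp
    show "l (h (s \<otimes> t)) = l (h s) * l (h t)" if "s \<in> ?T" "t \<in> ?T" for s t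
      using T(7)[of "h s" "h t"] that by simp
    show "\<exists>n\<in>{g \<in> carrier G. h g \<in> N}. l (h (inv g \<otimes> n \<otimes> g)) \<noteq> l (h n)"
      if g: "g \<in> carrier G - ?T" for g
    proof -
      have hg: "h g \<in> carrier H - T" using g by simp
      obtain n where n: "n \<in> N" "l (inv\<^bsub>H\<^esub> (h g) \<otimes>\<^bsub>H\<^esub> n \<otimes>\<^bsub>H\<^esub> h g) \<noteq> l n" using T(8)[OF hg] by (rule bexE)
      have "n \<in> h ` carrier G" unfolding surj using n(1) T(2) T.subset by blast
      then obtain m where m: "n = h m" "m \<in> carrier G" by (rule imageE)
      show ?thesis
        using n m g by (intro bexI[of _ m]) simp_all
    qed
  qed (fact subT proper odd)+
qed

text \<open>Take \<open>N\<close> of largest order among the normal subgroups whose quotient is not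
  2-nilpotent. A nontrivial normal subgroup of that quotient has a strictly larger preimage, so
  \<open>ex_odd_monomial_of_minimal\<close> applies to the quotient.\<close>

theorem (in group) ex_odd_monomial:
  assumes fin: "finite (carrier G)" and solv: "solvable G" and not: "\<not> p_nilpotent 2 G"
  obtains N T l where "odd_monomial G N T l"
proof -
  let ?P = "\<lambda>N. N \<lhd> G \<and> \<not> rel_two_nilpotent G N"
  have "?P {\<one>}" using one_is_normal not p_nilpotent_2_iff[OF fin] by simp
  moreover have "card N < Suc (Coset.order G)" if "?P N" for N
    using card_mono[OF fin subgroup.subset[OF normal_imp_subgroup[of N G]]] that
    by (simp add: Coset.order_def)
  ultimately obtain N where N: "?P N" and max: "\<And>M. ?P M \<Longrightarrow> card M \<le> card N"
    using ex_has_greatest_nat[of ?P "{\<one>}" card "Suc (Coset.order G)"] by (metis less_imp_le)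
  interpret N: normal N G using N by (rule conjunct1)
  let ?Q = "G Mod N" and ?h = "\<lambda>x. N #> x"
  interpret Q: group ?Q by (rule N.factorgroup_is_group)
  interpret h: group_hom G ?Q ?h
    using N.r_coset_hom_Mod by (simp add: group_hom_def group_hom_axioms_def is_group Q.is_group)
  have surj: "?h ` carrier G = carrier ?Q" by (simp add: carrier_FactGroup)
  have ker: "Coset.kernel G ?Q ?h = N" by (rule N.kernel_r_coset)
  have finQ: "finite (carrier ?Q)" unfolding surj[symmetric] using fin by simp
  have cardN: "card N \<noteq> 0" using h.card_kernel_neq_0[OF fin] unfolding ker .
  have "\<not> p_nilpotent 2 ?Q"
    using h.rel_two_nilpotent_kernel[OF surj fin] N Q.p_nilpotent_2_iff[OF finQ] unfolding ker by blast
  moreover have "rel_two_nilpotent ?Q L" if L: "L \<lhd> ?Q" "L \<noteq> {\<one>\<^bsub>?Q\<^esub>}" for L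
  proof -
    interpret L: normal L ?Q by (rule L(1))
    let ?M = "{g \<in> carrier G. ?h g \<in> L}"
    have M: "?M \<lhd> G" using L(1) by (rule h.normal_vimage)
    have finL: "finite L" using finQ L.subset finite_subset by blast
    have "{\<one>\<^bsub>?Q\<^esub>} \<subset> L" using L(2) L.one_closed by blast
    then have "card {\<one>\<^bsub>?Q\<^esub>} < card L" by (rule psubset_card_mono[OF finL])
    then have "1 < card L" by simp
    moreover have cM: "card ?M = card L * card N"
      using h.card_vimage[OF surj fin L.subset] unfolding ker .
    ultimately have "card N < card ?M" using cardN by simp
    then have rM: "rel_two_nilpotent G ?M" using max[of ?M] M by (meson linorder_not_less)
    have "Coset.kernel G ?Q ?h \<subseteq> ?M" using L.one_closed by (auto simp: kernel_def)
    then have "rel_two_nilpotent ?Q (?h ` ?M)"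
      by (rule h.rel_two_nilpotent_image[OF surj fin rM normal_imp_subgroup[OF M]])
    moreover have "?h ` ?M = L"
    proof
      show "L \<subseteq> ?h ` ?M"
      proof
        fix x assume x: "x \<in> L"
        then have "x \<in> ?h ` carrier G" using L.subset unfolding surj by blast
        then obtain g where "x = ?h g" "g \<in> carrier G" by (rule imageE)
        with x show "x \<in> ?h ` ?M" by (intro image_eqI[of _ _ g]) simp_all
      qed
    qed blast
    ultimately show ?thesis by simp
  qed
  ultimately obtain N' T l where "odd_monomial ?Q N' T l"
    using Q.ex_odd_monomial_of_minimal[OF finQ h.surj_hom_imp_solvable[OF surj solv]] by blast
  then show thesis using h.odd_monomial_vimage[OF surj fin] that by blast
qed

section \<open>Finiteness of the set of irreducible characters\<close>

lemma carrier_GL: "A \<in> carrier (GL n) \<longleftrightarrow> A \<in> carrier_mat n n \<and> (\<exists>B\<in>carrier_mat n n. B * A = 1\<^sub>m n \<and> A * B = 1\<^sub>m n)"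
  by (simp add: GL_def units_of_carrier Units_def ring_mat_simps)

lemma mult_GL [simp]: "A \<otimes>\<^bsub>GL n\<^esub> B = A * B"
  by (simp add: GL_def units_of_mult ring_mat_simps)

lemma one_GL [simp]: "\<one>\<^bsub>GL n\<^esub> = 1\<^sub>m n"
  by (simp add: GL_def units_of_one ring_mat_simps)

lemma group_GL: "group (GL n)"
proof -
  interpret ring "ring_mat TYPE(complex) n ()" by (rule ring_mat)
  show ?thesis unfolding GL_def by (rule units_group)
qed

text \<open>Invertibility follows from the last two conditions, which make
  \<open>\<rho> (inv g)\<close> a two-sided inverse of \<open>\<rho> g\<close>.\<close>

lemma (in group) hom_GL_iff:
  "\<rho> \<in> hom G (GL n) \<longleftrightarrow>
     (\<forall>g\<in>carrier G. \<rho> g \<in> carrier_mat n n) \<and>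
     (\<forall>g\<in>carrier G. \<forall>h\<in>carrier G. \<rho> (g \<otimes> h) = \<rho> g * \<rho> h) \<and> \<rho> \<one> = 1\<^sub>m n"
    (is "_ \<longleftrightarrow> ?R")
proof
  assume h: "\<rho> \<in> hom G (GL n)"
  interpret group_hom G "GL n" \<rho>
    using h by (simp add: group_hom_def group_hom_axioms_def group_GL is_group)
  have "\<rho> g \<in> carrier_mat n n" if "g \<in> carrier G" for g
    using hom_closed[OF that] unfolding carrier_GL by (rule conjunct1)
  then show ?R using hom_one hom_mult by simp
next
  assume r: ?R
  have "\<rho> g \<in> carrier (GL n)" if g: "g \<in> carrier G" for g
  proof -
    have "\<rho> (inv g) * \<rho> g = 1\<^sub>m n" "\<rho> g * \<rho> (inv g) = 1\<^sub>m n"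
      using r g l_inv[OF g] r_inv[OF g] inv_closed[OF g] by metis+
    moreover have "\<rho> g \<in> carrier_mat n n" "\<rho> (inv g) \<in> carrier_mat n n" using r g by simp_all
    ultimately show ?thesis unfolding carrier_GL by blast
  qed
  then show "\<rho> \<in> hom G (GL n)" using r by (simp add: hom_def)
qed

lemma invariant_subspaceI:
  assumes "W \<subseteq> carrier_vec n" "0\<^sub>v n \<in> W"
    and "\<And>v w. v \<in> W \<Longrightarrow> w \<in> W \<Longrightarrow> v + w \<in> W"
    and "\<And>c w. w \<in> W \<Longrightarrow> c \<cdot>\<^sub>v w \<in> W"
    and "\<And>g w. g \<in> carrier G \<Longrightarrow> w \<in> W \<Longrightarrow> \<rho> g *\<^sub>v w \<in> W"
  shows "invariant_subspace G n \<rho> W"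
  using assms vec_vs vec_module unfolding invariant_subspace_def
  by (auto intro!: VectorSpace.subspace.intro submodule.intro simp: module_vec_simps)

lemma invariant_subspaceD:
  assumes "invariant_subspace G n \<rho> W"
  shows "W \<subseteq> carrier_vec n" "0\<^sub>v n \<in> W"
    and "\<And>v w. v \<in> W \<Longrightarrow> w \<in> W \<Longrightarrow> v + w \<in> W"
    and "\<And>c w. w \<in> W \<Longrightarrow> c \<cdot>\<^sub>v w \<in> W"
    and "\<And>g w. g \<in> carrier G \<Longrightarrow> w \<in> W \<Longrightarrow> \<rho> g *\<^sub>v w \<in> W"
proof -
  have "submodule class_ring W (module_vec TYPE(complex) n)"
    using assms unfolding invariant_subspace_def VectorSpace.subspace_def by blast
  note s = submodule.subset[OF this] submodule.zero_closed[OF this] submodule.m_closed[OF this]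
    submodule.smult_closed[OF this]
  show "W \<subseteq> carrier_vec n" "0\<^sub>v n \<in> W" using s(1,2) by (simp_all add: module_vec_simps)
  show "v + w \<in> W" if "v \<in> W" "w \<in> W" for v w
    using s(3)[OF that] by (simp add: module_vec_simps)
  show "c \<cdot>\<^sub>v w \<in> W" if "w \<in> W" for c w
    using s(4)[OF _ that, of c] by (simp add: module_vec_simps)
  show "\<rho> g *\<^sub>v w \<in> W" if "g \<in> carrier G" "w \<in> W" for g w
    using assms that unfolding invariant_subspace_def by blast
qed

section \<open>Traces of matrices of finite order and the bound on the dimension\<close>

lemma mat_trace_mult_commute:
  assumes "A \<in> carrier_mat n m" "B \<in> carrier_mat m n"
  shows "mat_trace (A * B) = mat_trace (B * A)"
proof -
  have "mat_trace (A * B) = (\<Sum>i<n. \<Sum>j<m. A $$ (i, j) * B $$ (j, i))"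
    using assms by (simp add: mat_trace_def scalar_prod_def atLeast0LessThan)
  also have "\<dots> = (\<Sum>j<m. \<Sum>i<n. B $$ (j, i) * A $$ (i, j))"
    by (subst sum.swap) (simp add: mult.commute)
  also have "\<dots> = mat_trace (B * A)"
    using assms by (simp add: mat_trace_def scalar_prod_def atLeast0LessThan)
  finally show ?thesis .
qed

text \<open>The Schur form is similar to \<open>A\<close> and has the eigenvalues on its diagonal,
  so the trace is their sum; applying \<open>A ^\<^sub>m m\<close> to an eigenvector shows that each
  of them is a root of unity.\<close>

lemma mat_trace_roots_of_unity:
  assumes A: "A \<in> carrier_mat n n" and pow: "A ^\<^sub>m m = 1\<^sub>m n"
  obtains es where "length es = n" "mat_trace A = sum_list es" "\<forall>e\<in>set es. e ^ m = 1"
proof -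
  obtain es where es: "char_poly A = (\<Prod>a\<leftarrow>es. [:- a, 1:])" "length es = n"
    using char_poly_factorized[OF A] by blast
  obtain B P Q where BPQ: "schur_decomposition A es = (B, P, Q)" by (metis prod_cases3)
  have sd: "similar_mat_wit A B P Q" "diag_mat B = es"
    using schur_decomposition[OF A es(1) BPQ] by blast+
  note w = similar_mat_witD2[OF A sd(1)]
  have "mat_trace A = mat_trace (P * B * Q)" using w(3) by simp
  also have "\<dots> = mat_trace (Q * (P * B))"
    using w by (intro mat_trace_mult_commute[of _ n n]) auto
  also have "Q * (P * B) = (Q * P) * B" using w by (intro assoc_mult_mat[symmetric]) auto
  also have "\<dots> = B" using w by simp
  also have "mat_trace B = sum_list es"
    unfolding sd(2)[symmetric] by (simp add: mat_trace_def diag_mat_def interv_sum_list_conv_sum_set_nat atLeast0LessThan)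
  finally have tr: "mat_trace A = sum_list es" .
  have "e ^ m = 1" if "e \<in> set es" for e
  proof -
    have "poly (char_poly A) e = 0" unfolding es(1) using that by (auto simp: poly_prod_list_zero_iff)
    then obtain v where v: "eigenvector A v e"
      using eigenvalue_root_char_poly[OF A] unfolding eigenvalue_def by blast
    have vn: "v \<in> carrier_vec n" "v \<noteq> 0\<^sub>v n" using v A unfolding eigenvector_def by auto
    have "v = e ^ m \<cdot>\<^sub>v v" using eigenvector_pow[OF A v, of m] pow vn by simp
    moreover obtain i where "i < n" "v $ i \<noteq> 0"
      using vn by (metis carrier_vecD eq_vecI index_zero_vec(1) index_zero_vec(2))
    ultimately show ?thesis using vn by (metis carrier_vecD index_smult_vec(1) mult_cancel_right2)
  qed
  with es(2) tr that show thesis by blast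
qed

text \<open>If \<open>n\<close> exceeded the order of \<open>G\<close>, some \<open>u \<noteq> 0\<close> would be orthogonal to the orbit of a vector \<open>v \<noteq> 0\<close>, and
  the vectors whose orbits are orthogonal to \<open>u\<close> would form a proper invariant subspace.\<close>

lemma (in group) irreducible_rep_dim_le:
  assumes fin: "finite (carrier G)" and irr: "irreducible_rep G n \<rho>"
  shows "n \<le> card (carrier G)"
proof (rule ccontr)
  let ?m = "card (carrier G)"
  assume "\<not> n \<le> ?m"
  then have mn: "?m < n" by simp
  have n: "n > 0" and hom: "\<rho> \<in> hom G (GL n)"
    and inv: "\<And>W. invariant_subspace G n \<rho> W \<Longrightarrow> W = {0\<^sub>v n} \<or> W = carrier_vec n"
    using irr unfolding irreducible_rep_def by blast+
  have \<rho>: "\<And>g. g \<in> carrier G \<Longrightarrow> \<rho> g \<in> carrier_mat n n"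
    "\<And>g h. g \<in> carrier G \<Longrightarrow> h \<in> carrier G \<Longrightarrow> \<rho> (g \<otimes> h) = \<rho> g * \<rho> h" "\<rho> \<one> = 1\<^sub>m n"
    using hom unfolding hom_GL_iff by blast+
  obtain f where f: "bij_betw f {..<?m} (carrier G)"
    using ex_bij_betw_nat_finite[OF fin] by (auto simp: atLeast0LessThan)
  define v where "v = (unit_vec n 0 :: complex vec)"
  have v: "v \<in> carrier_vec n" "v \<noteq> 0\<^sub>v n" using n by (auto simp: v_def)
  \<comment> \<open>The orbit of \<open>v\<close> fills the first \<open>?m\<close> rows, and zero
    rows make the matrix square. Since \<open>?m < n\<close>, the last row vanishes and the
    determinant is 0, which produces \<open>u\<close>.\<close>
  define A where "A = mat n n (\<lambda>(i, j). if i < ?m then (\<rho> (f i) *\<^sub>v v) $ j else 0)"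
  have A: "A \<in> carrier_mat n n" by (simp add: A_def)
  have "A\<^sup>T *\<^sub>v unit_vec n (n - 1) = 0\<^sub>v n"
  proof (rule eq_vecI)
    fix i assume i: "i < dim_vec (0\<^sub>v n :: complex vec)"
    then have "(A\<^sup>T *\<^sub>v unit_vec n (n - 1)) $ i = col A i \<bullet> unit_vec n (n - 1)" using A by simp
    also have "\<dots> = col A i $ (n - 1)" using i A n by (intro scalar_prod_right_unit) simp_all
    also have "\<dots> = 0" using i mn by (simp add: A_def)
    finally show "(A\<^sup>T *\<^sub>v unit_vec n (n - 1)) $ i = 0\<^sub>v n $ i" using i by simp
  qed (use A in simp)
  moreover have "(unit_vec n (n - 1) :: complex vec) \<noteq> 0\<^sub>v n" using n by simp
  ultimately have "det A\<^sup>T = 0"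
    using A by (subst det_0_iff_vec_prod_zero_field[of _ n]) (auto intro: exI[of _ "unit_vec n (n - 1)"])
  then have "det A = 0" using det_transpose[OF A] by simp
  then obtain u where u: "u \<in> carrier_vec n" "u \<noteq> 0\<^sub>v n" "A *\<^sub>v u = 0\<^sub>v n"
    using det_0_iff_vec_prod_zero_field[OF A] by blast
  have orth: "(\<rho> g *\<^sub>v v) \<bullet> u = 0" if g: "g \<in> carrier G" for g
  proof -
    have "g \<in> f ` {..<?m}" using f g by (simp add: bij_betw_def)
    then obtain i where i: "i < ?m" "g = f i" by blast
    have "row A i = \<rho> g *\<^sub>v v"
      using i mn \<rho>(1)[OF g] by (intro eq_vecI) (simp_all add: A_def)
    moreover have "row A i \<bullet> u = (A *\<^sub>v u) $ i" using i mn A by simp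
    ultimately show ?thesis using u(3) i mn by simp
  qed
  define W where "W = {w \<in> carrier_vec n. \<forall>g\<in>carrier G. (\<rho> g *\<^sub>v w) \<bullet> u = 0}"
  have "invariant_subspace G n \<rho> W"
  proof (rule invariant_subspaceI)
    show "W \<subseteq> carrier_vec n" unfolding W_def by blast
    have "\<rho> g *\<^sub>v 0\<^sub>v n = 0\<^sub>v n" if "g \<in> carrier G" for g
      using \<rho>(1)[OF that] by (intro eq_vecI) auto
    then show "0\<^sub>v n \<in> W" using u(1) by (simp add: W_def)
    show "x + y \<in> W" if "x \<in> W" "y \<in> W" for x y
    proof -
      have "(\<rho> g *\<^sub>v (x + y)) \<bullet> u = 0" if g: "g \<in> carrier G" for g
      proof -
        have "\<rho> g *\<^sub>v (x + y) = \<rho> g *\<^sub>v x + \<rho> g *\<^sub>v y"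
          using \<rho>(1)[OF g] \<open>x \<in> W\<close> \<open>y \<in> W\<close> by (intro mult_add_distrib_mat_vec) (auto simp: W_def)
        then have "(\<rho> g *\<^sub>v (x + y)) \<bullet> u = (\<rho> g *\<^sub>v x) \<bullet> u + (\<rho> g *\<^sub>v y) \<bullet> u"
          using \<rho>(1)[OF g] \<open>x \<in> W\<close> \<open>y \<in> W\<close> u(1) by (simp add: add_scalar_prod_distrib[of _ n] W_def)
        then show ?thesis using \<open>x \<in> W\<close> \<open>y \<in> W\<close> g by (simp add: W_def)
      qed
      then show ?thesis using that by (simp add: W_def)
    qed
    show "c \<cdot>\<^sub>v x \<in> W" if x: "x \<in> W" for c x
    proof -
      have "(\<rho> g *\<^sub>v (c \<cdot>\<^sub>v x)) \<bullet> u = 0" if g: "g \<in> carrier G" for g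
      proof -
        have "\<rho> g *\<^sub>v (c \<cdot>\<^sub>v x) = c \<cdot>\<^sub>v (\<rho> g *\<^sub>v x)"
          using \<rho>(1)[OF g] x by (intro mult_mat_vec) (auto simp: W_def)
        then show ?thesis using \<rho>(1)[OF g] u(1) x g by (simp add: W_def)
      qed
      then show ?thesis using x by (simp add: W_def)
    qed
    show "\<rho> h *\<^sub>v x \<in> W" if h: "h \<in> carrier G" and x: "x \<in> W" for h x
    proof -
      have "(\<rho> g *\<^sub>v (\<rho> h *\<^sub>v x)) \<bullet> u = 0" if g: "g \<in> carrier G" for g
      proof -
        have "\<rho> g *\<^sub>v (\<rho> h *\<^sub>v x) = \<rho> (g \<otimes> h) *\<^sub>v x"
          using \<rho>(1)[OF g] \<rho>(1)[OF h] \<rho>(2)[OF g h] x by (simp add: W_def)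
        then show ?thesis using x g h by (simp add: W_def)
      qed
      then show ?thesis using \<rho>(1)[OF h] x by (simp add: W_def)
    qed
  qed
  moreover have "v \<in> W" using v orth by (simp add: W_def)
  ultimately have W: "W = carrier_vec n" using inv v(2) by blast
  have "u $ i = 0" if i: "i < n" for i
  proof -
    have "unit_vec n i \<in> W" unfolding W by simp
    then have "(\<rho> \<one> *\<^sub>v unit_vec n i) \<bullet> u = 0" unfolding W_def by blast
    then show ?thesis using \<rho>(3) i u(1) by simp
  qed
  then have "u = 0\<^sub>v n" using u(1) by (intro eq_vecI) simp_all
  with u(2) show False by blast
qed

lemma (in group) rep_pow:
  assumes "\<rho> \<in> hom G (GL n)" "g \<in> carrier G"
  shows "\<rho> (g [^] (k::nat)) = \<rho> g ^\<^sub>m k"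
proof (induction k)
  case 0
  have "dim_row (\<rho> g) = n" using assms unfolding hom_GL_iff by blast
  then show ?case using assms unfolding hom_GL_iff by simp
next
  case (Suc k)
  have "\<rho> (g [^] k \<otimes> g) = \<rho> (g [^] k) * \<rho> g"
    using assms unfolding hom_GL_iff by simp
  then show ?case using Suc by simp
qed

text \<open>Each value is a sum of at most \<open>card (carrier G)\<close> roots of unity, which
  leaves finitely many functions. Finiteness matters because over an infinite set the sum and
  \<open>card\<close> are both 0 by convention, and so would be the average.\<close>

lemma (in group) finite_Irr:
  assumes fin: "finite (carrier G)"
  shows "finite (Irr G)"
proof -
  let ?m = "card (carrier G)"
  define U where "U = {e::complex. e ^ ?m = 1}"
  have m: "?m > 0" using fin one_closed by (auto simp: card_gt_0_iff)
  have finU: "finite U"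
    unfolding U_def using finite_roots_unity[of ?m] m by simp
  define V where "V = sum_list ` {es. set es \<subseteq> U \<and> length es \<le> ?m}"
  have "finite V" unfolding V_def using finU by (intro finite_imageI finite_lists_length_le)
  then have finP: "finite (carrier G \<rightarrow>\<^sub>E V)" using fin by (intro finite_PiE)
  have "Irr G \<subseteq> carrier G \<rightarrow>\<^sub>E V"
  proof
    fix \<chi> assume "\<chi> \<in> Irr G"
    then obtain n \<rho> where irr: "irreducible_rep G n \<rho>" and \<chi>: "\<chi> = rep_char G \<rho>"
      unfolding Irr_def by blast
    have hom: "\<rho> \<in> hom G (GL n)" using irr unfolding irreducible_rep_def by blast
    have "mat_trace (\<rho> g) \<in> V" if g: "g \<in> carrier G" for g
    proof -
      have A: "\<rho> g \<in> carrier_mat n n" and one: "\<rho> \<one> = 1\<^sub>m n" using hom g unfolding hom_GL_iff by blast+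
      have "g [^] ?m = \<one>" using pow_order_eq_1[OF g] by (simp add: Coset.order_def)
      then have pow: "\<rho> g ^\<^sub>m ?m = 1\<^sub>m n" using rep_pow[OF hom g, of ?m] one by simp
      obtain es where es: "length es = n" "mat_trace (\<rho> g) = sum_list es" "\<forall>e\<in>set es. e ^ ?m = 1"
        by (rule mat_trace_roots_of_unity[OF A pow])
      show ?thesis
        unfolding V_def es(2) using es(1,3) irreducible_rep_dim_le[OF fin irr]
        by (intro imageI) (auto simp: U_def)
    qed
    then show "\<chi> \<in> carrier G \<rightarrow>\<^sub>E V" unfolding \<chi> rep_char_def by auto
  qed
  then show ?thesis using finP by (rule finite_subset)
qed

section \<open>Induced representations\<close>

text \<open>Induction by squaring \<open>f\<close>: the points fixed by \<open>f \<circ> f\<close>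
  but not by \<open>f\<close> are paired off by \<open>f\<close>, so the two fixed point sets have
  sizes of equal parity.\<close>

lemma even_card_fixed_points:
  assumes "finite X" "\<And>x. x \<in> X \<Longrightarrow> f x \<in> X" "\<And>x. x \<in> X \<Longrightarrow> (f ^^ (2 ^ k)) x = x"
  shows "even (card {x \<in> X. f x = x}) \<longleftrightarrow> even (card X)"
  using assms(2,3)
proof (induction k arbitrary: f)
  case 0
  then have "{x \<in> X. f x = x} = X" by auto
  then show ?case by simp
next
  case (Suc k)
  let ?F = "{x \<in> X. f (f x) = x}" and ?A = "{x \<in> X. f x = x}" and ?B = "{x \<in> X. f (f x) = x \<and> f x \<noteq> x}"
  have pow: "((f \<circ> f) ^^ m) x = (f ^^ (2 * m)) x" for m x by (induction m arbitrary: x) simp_all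
  have "even (card {x \<in> X. (f \<circ> f) x = x}) \<longleftrightarrow> even (card X)"
  proof (rule Suc.IH)
    show "((f \<circ> f) ^^ (2 ^ k)) x = x" if "x \<in> X" for x
      using Suc.prems(2)[OF that] unfolding pow power_Suc .
  qed (use Suc.prems(1) in simp)
  moreover have "even (card ?B)"
    by (rule even_card_involution[of _ f]) (use assms(1) Suc.prems(1) in auto)
  moreover have "card ?F = card ?A + card ?B"
  proof -
    have "?F = ?A \<union> ?B" by auto
    then show ?thesis using assms(1) by (simp only:) (intro card_Un_disjoint; auto)
  qed
  ultimately show ?case by simp
qed

text \<open>The \<open>x i\<close> represent the left cosets of \<open>T\<close>: by
  \<open>transversal\<close> each \<open>g\<close> lies in \<open>x i <# T\<close> for exactly one
  \<open>i\<close>.\<close>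

locale monomial_representation = group G for G (structure) +
  fixes N T :: "'a set" and l :: "'a \<Rightarrow> int" and x :: "nat \<Rightarrow> 'a" and n :: nat
  assumes normal: "N \<lhd> G" and N_T: "N \<subseteq> T" and T: "subgroup T G"
    and sign: "\<And>t. t \<in> T \<Longrightarrow> l t = 1 \<or> l t = -1"
    and mult: "\<And>s t. s \<in> T \<Longrightarrow> t \<in> T \<Longrightarrow> l (s \<otimes> t) = l s * l t"
    and separating: "\<And>g. g \<in> carrier G - T \<Longrightarrow> \<exists>m\<in>N. l (inv g \<otimes> m \<otimes> g) \<noteq> l m"
    and x_closed: "\<And>i. i < n \<Longrightarrow> x i \<in> carrier G"
    and transversal: "\<And>g. g \<in> carrier G \<Longrightarrow> \<exists>!i. i < n \<and> inv (x i) \<otimes> g \<in> T"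
    and n_pos: "n > 0"
begin

sublocale N: normal N G by (rule normal)
sublocale T: subgroup T G by (rule T)

definition c :: "'a \<Rightarrow> int" where "c g = (if g \<in> T then l g else 0)"

text \<open>The representation induced from \<open>l\<close>, in the basis given by the
  \<open>x i\<close>. For \<open>g\<close> in the group this is a signed permutation matrix; the
  permutation is that of the left cosets of \<open>T\<close>.\<close>

definition ind :: "'a \<Rightarrow> complex mat" where
  "ind g = mat n n (\<lambda>(i, j). of_int (c (inv (x i) \<otimes> g \<otimes> x j)))"

definition idx :: "'a \<Rightarrow> nat" where "idx g = (THE i. i < n \<and> inv (x i) \<otimes> g \<in> T)"

lemma idx: assumes "g \<in> carrier G" shows "idx g < n" "inv (x (idx g)) \<otimes> g \<in> T"
  using theI'[OF transversal[OF assms]] unfolding idx_def by blast+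

lemma idx_unique: "g \<in> carrier G \<Longrightarrow> i < n \<Longrightarrow> inv (x i) \<otimes> g \<in> T \<Longrightarrow> i = idx g"
  using transversal[of g] idx[of g] by blast

lemma x_inv_x: assumes "i < n" "j < n" shows "inv (x i) \<otimes> x j \<in> T \<longleftrightarrow> i = j"
proof
  assume "inv (x i) \<otimes> x j \<in> T"
  moreover have "inv (x j) \<otimes> x j \<in> T" using x_closed[OF assms(2)] by simp
  ultimately show "i = j" using idx_unique[OF x_closed[OF assms(2)]] assms by metis
next
  assume "i = j"
  then show "inv (x i) \<otimes> x j \<in> T" using x_closed[OF assms(2)] by simp
qed

lemma l_one: "l \<one> = 1"
  using mult[of \<one> \<one>] sign[of \<one>] by auto

lemma mult_right_in_T: assumes "s \<in> carrier G" "t \<in> T" shows "s \<otimes> t \<in> T \<longleftrightarrow> s \<in> T"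
proof
  assume "s \<otimes> t \<in> T"
  then have "s \<otimes> t \<otimes> inv t \<in> T" using assms(2) by blast
  then show "s \<in> T" using assms by (simp add: m_assoc)
qed (use assms in blast)

lemma c_mult_right: assumes "s \<in> carrier G" "t \<in> T" shows "c (s \<otimes> t) = c s * c t"
  using assms mult by (simp add: c_def mult_right_in_T)

lemma c_x_inv_x: assumes "i < n" "j < n" shows "c (inv (x i) \<otimes> x j) = (if i = j then 1 else 0)"
  using assms x_closed[OF assms(1)] by (auto simp: c_def x_inv_x l_one)

lemma ind_carrier: "ind g \<in> carrier_mat n n" by (simp add: ind_def)

lemma ind_mult:
  assumes g: "g \<in> carrier G" and h: "h \<in> carrier G"
  shows "ind (g \<otimes> h) = ind g * ind h"
proof (rule eq_matI)
  fix i j assume "i < dim_row (ind g * ind h)" "j < dim_col (ind g * ind h)"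
  then have ij: "i < n" "j < n" by (simp_all add: ind_def)
  note cl = x_closed[OF ij(1)] x_closed[OF ij(2)]
  let ?f = "\<lambda>k. c (inv (x i) \<otimes> g \<otimes> x k) * c (inv (x k) \<otimes> h \<otimes> x j)"
  \<comment> \<open>Only the coset containing \<open>h \<otimes> x j\<close> contributes to the sum
    over \<open>k\<close>; elsewhere the second factor of \<open>?f k\<close> is 0.\<close>
  let ?k = "idx (h \<otimes> x j)"
  have hx: "h \<otimes> x j \<in> carrier G" using h cl by simp
  have k: "?k < n" "inv (x ?k) \<otimes> (h \<otimes> x j) \<in> T" using idx[OF hx] by simp_all
  have xk: "x ?k \<in> carrier G" using x_closed[OF k(1)] .
  have zero: "?f k = 0" if "k \<in> {..<n} - {?k}" for k
  proof -
    have kn: "k < n" "k \<noteq> ?k" using that by simp_all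
    then have "inv (x k) \<otimes> (h \<otimes> x j) \<notin> T" using idx_unique[OF hx kn(1)] by blast
    then have "inv (x k) \<otimes> h \<otimes> x j \<notin> T" using h cl x_closed[OF kn(1)] by (simp add: m_assoc)
    then show ?thesis by (simp add: c_def)
  qed
  have "sum ?f {..<n} = ?f ?k + sum ?f ({..<n} - {?k})"
    using k(1) by (intro sum.remove) simp_all
  also have "sum ?f ({..<n} - {?k}) = 0" using zero by (rule sum.neutral[OF ballI])
  finally have "sum ?f {..<n} = ?f ?k" by simp
  also have "\<dots> = c ((inv (x i) \<otimes> g \<otimes> x ?k) \<otimes> (inv (x ?k) \<otimes> (h \<otimes> x j)))"
    using g h cl xk k(2) by (subst c_mult_right) (simp_all add: m_assoc)
  also have "(inv (x i) \<otimes> g \<otimes> x ?k) \<otimes> (inv (x ?k) \<otimes> (h \<otimes> x j)) = inv (x i) \<otimes> (g \<otimes> h) \<otimes> x j"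
    using g h cl xk by (simp add: m_assoc inv_mult_cancel)
  finally have eq: "sum ?f {..<n} = c (inv (x i) \<otimes> (g \<otimes> h) \<otimes> x j)" .
  have "(ind g * ind h) $$ (i, j) = of_int (sum ?f {..<n})"
    using ij by (simp add: ind_def scalar_prod_def atLeast0LessThan)
  then show "ind (g \<otimes> h) $$ (i, j) = (ind g * ind h) $$ (i, j)"
    using ij unfolding eq by (simp add: ind_def)
qed (simp_all add: ind_def)

lemma ind_one: "ind \<one> = 1\<^sub>m n"
  by (rule eq_matI) (simp_all add: ind_def c_x_inv_x x_closed)

lemma ind_hom: "ind \<in> hom G (GL n)"
  using ind_carrier ind_mult ind_one by (simp add: hom_GL_iff)

text \<open>Normality puts every conjugate of \<open>y\<close> into \<open>T\<close>, so
  \<open>y\<close> fixes all cosets and \<open>N\<close> acts diagonally, through the conjugates of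
  \<open>l\<close>.\<close>

lemma ind_normal:
  assumes y: "y \<in> N" and w: "w \<in> carrier_vec n" and i: "i < n"
  shows "(ind y *\<^sub>v w) $ i = of_int (l (inv (x i) \<otimes> y \<otimes> x i)) * w $ i"
proof -
  have xi: "x i \<in> carrier G" using x_closed[OF i] .
  let ?m = "inv (x i) \<otimes> y \<otimes> x i"
  have m: "?m \<in> T" using N.inv_op_closed1[OF xi y] N_T by blast
  have entry: "c (inv (x i) \<otimes> y \<otimes> x j) = (if j = i then l ?m else 0)" if j: "j < n" for j
  proof -
    have xj: "x j \<in> carrier G" using x_closed[OF j] .
    have "inv (x i) \<otimes> y \<otimes> x j \<in> T \<longleftrightarrow> j = i"
    proof
      assume "inv (x i) \<otimes> y \<otimes> x j \<in> T"
      then have "inv ?m \<otimes> (inv (x i) \<otimes> y \<otimes> x j) \<in> T" using m by blast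
      moreover have "inv ?m \<otimes> (inv (x i) \<otimes> y \<otimes> x j) = inv (x i) \<otimes> x j"
        using xi xj y by (simp add: inv_mult_group m_assoc inv_mult_cancel)
      ultimately show "j = i" using x_inv_x[OF i j] by simp
    qed (use m in simp)
    then show ?thesis by (simp add: c_def)
  qed
  have "(ind y *\<^sub>v w) $ i = (\<Sum>j<n. of_int (c (inv (x i) \<otimes> y \<otimes> x j)) * w $ j)"
    using i w by (simp add: ind_def scalar_prod_def atLeast0LessThan)
  also have "\<dots> = (\<Sum>j<n. if j = i then of_int (l ?m) * w $ j else 0)"
    by (rule sum.cong) (simp_all add: entry)
  also have "\<dots> = of_int (l ?m) * w $ i" using i by simp
  finally show ?thesis .
qed

text \<open>Because of this transitivity, an invariant subspace that contains one basis vector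
  contains all of them.\<close>

lemma ind_unit_vec:
  assumes i: "i < n" and j: "j < n"
  shows "ind (x j \<otimes> inv (x i)) *\<^sub>v unit_vec n i = unit_vec n j"
proof (rule eq_vecI)
  fix k assume "k < dim_vec (unit_vec n j :: complex vec)"
  then have k: "k < n" by simp
  note cl = x_closed[OF i] x_closed[OF j] x_closed[OF k]
  have "(ind (x j \<otimes> inv (x i)) *\<^sub>v unit_vec n i) $ k = ind (x j \<otimes> inv (x i)) $$ (k, i)"
    using i k ind_carrier[of "x j \<otimes> inv (x i)"] by simp
  also have "\<dots> = of_int (c (inv (x k) \<otimes> x j))"
    using i k cl by (simp add: ind_def m_assoc)
  finally show "(ind (x j \<otimes> inv (x i)) *\<^sub>v unit_vec n i) $ k = unit_vec n j $ k"
    using j k by (simp add: c_x_inv_x)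
qed (simp add: ind_def)

text \<open>Since \<open>N\<close> acts diagonally with pairwise distinct characters, a nonzero vector of minimal support
  in an invariant subspace is a multiple of a basis vector.\<close>

lemma irreducible_ind: "irreducible_rep G n ind"
  unfolding irreducible_rep_def
proof (intro conjI allI impI n_pos ind_hom)
  fix W assume inv: "invariant_subspace G n ind W"
  note W = invariant_subspaceD[OF inv]
  show "W = {0\<^sub>v n} \<or> W = carrier_vec n"
  proof (cases "W = {0\<^sub>v n}")
    case False
    let ?supp = "\<lambda>w::complex vec. {i. i < n \<and> w $ i \<noteq> 0}"
    let ?P = "\<lambda>w. w \<in> W \<and> w \<noteq> 0\<^sub>v n"
    obtain w0 where "?P w0" using False W(2) by blast
    then obtain w where w: "?P w" and least: "\<And>v. ?P v \<Longrightarrow> card (?supp w) \<le> card (?supp v)"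
      using ex_has_least_nat[of ?P w0 "\<lambda>w. card (?supp w)"] by blast
    have wn: "w \<in> carrier_vec n" using w W(1) by blast
    obtain i where i: "i < n" "w $ i \<noteq> 0"
      using wn w by (metis carrier_vecD eq_vecI index_zero_vec(1) index_zero_vec(2))
    have single: "w $ j = 0" if j: "j < n" "j \<noteq> i" for j
    proof (rule ccontr)
      assume wj: "w $ j \<noteq> 0"
      have xi: "x i \<in> carrier G" and xj: "x j \<in> carrier G" using x_closed i j by blast+
      let ?g = "inv (x i) \<otimes> x j"
      have "?g \<in> carrier G - T" using x_inv_x[OF i(1) j(1)] j(2) xi xj by simp
      then obtain m where m: "m \<in> N" "l (inv ?g \<otimes> m \<otimes> ?g) \<noteq> l m" using separating by blast
      \<comment> \<open>Conjugation by \<open>x i\<close> makes the diagonal entry of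
        \<open>?y\<close> at \<open>i\<close> equal to \<open>l m\<close>. At \<open>j\<close> it is
        the value of \<open>l\<close> at the conjugate of \<open>m\<close> by \<open>?g\<close>,
        which differs by the choice of \<open>m\<close>.\<close>
      let ?y = "x i \<otimes> m \<otimes> inv (x i)"
      have mG: "m \<in> carrier G" using m(1) by simp
      have y: "?y \<in> N" using N.inv_op_closed2[OF xi m(1)] .
      have di: "inv (x i) \<otimes> ?y \<otimes> x i = m"
        using xi mG by (simp add: m_assoc inv_mult_cancel)
      have dj: "inv (x j) \<otimes> ?y \<otimes> x j = inv ?g \<otimes> m \<otimes> ?g"
        using xi xj mG by (simp add: m_assoc inv_mult_group)
      \<comment> \<open>This combination kills coordinate \<open>i\<close> but not \<open>j\<close>,
        so its support is strictly smaller than that of \<open>w\<close>.\<close>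
      define v where "v = ind ?y *\<^sub>v w + (- of_int (l m)) \<cdot>\<^sub>v w"
      have "?y \<in> carrier G" using y by simp
      then have vW: "v \<in> W" unfolding v_def using w by (intro W(3,4,5)) auto
      have vk: "v $ k = (of_int (l (inv (x k) \<otimes> ?y \<otimes> x k)) - of_int (l m)) * w $ k" if "k < n" for k
        using that wn ind_normal[OF y wn that] ind_carrier[of ?y] by (simp add: v_def algebra_simps)
      have "v $ j \<noteq> 0" using vk[OF j(1)] wj m(2) unfolding dj by simp
      then have "v \<noteq> 0\<^sub>v n" using j(1) by auto
      moreover have "?supp v \<subset> ?supp w"
      proof
        show "?supp v \<subseteq> ?supp w" using vk by auto
        have "v $ i = 0" using vk[OF i(1)] unfolding di by simp
        then show "?supp v \<noteq> ?supp w" using i by blast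
      qed
      then have "card (?supp v) < card (?supp w)" by (intro psubset_card_mono) simp_all
      ultimately show False using least[of v] vW by simp
    qed
    have "(1 / w $ i) \<cdot>\<^sub>v w = unit_vec n i"
      using wn i single by (intro eq_vecI) auto
    moreover have "(1 / w $ i) \<cdot>\<^sub>v w \<in> W" using w W(4) by blast
    ultimately have ui: "unit_vec n i \<in> W" by simp
    have units: "unit_vec n j \<in> W" if j: "j < n" for j
    proof -
      have "ind (x j \<otimes> inv (x i)) *\<^sub>v unit_vec n i \<in> W"
        using ui x_closed[OF j] x_closed[OF i(1)] by (intro W(5)) simp_all
      then show ?thesis unfolding ind_unit_vec[OF i(1) j] .
    qed
    have "v \<in> W" if v: "v \<in> carrier_vec n" for v
    proof -
      have "k \<le> n \<Longrightarrow> vec n (\<lambda>i. if i < k then v $ i else 0) \<in> W" for k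
      proof (induction k)
        case 0
        have "vec n (\<lambda>i. if i < 0 then v $ i else 0) = 0\<^sub>v n" by (intro eq_vecI) simp_all
        then show ?case using W(2) by simp
      next
        case (Suc k)
        have "vec n (\<lambda>i. if i < Suc k then v $ i else 0) =
            vec n (\<lambda>i. if i < k then v $ i else 0) + v $ k \<cdot>\<^sub>v unit_vec n k"
          using Suc.prems by (intro eq_vecI) (auto simp: less_Suc_eq)
        then show ?case using Suc W(3)[OF _ W(4)[OF units[of k]]] by simp
      qed
      from this[of n] have "vec n (\<lambda>i. if i < n then v $ i else 0) \<in> W" by simp
      moreover have "vec n (\<lambda>i. if i < n then v $ i else 0) = v" using v by (intro eq_vecI) auto
      ultimately show ?thesis by simp
    qed
    then show ?thesis using W(1) by blast
  qed simp
qed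

lemma trace_ind: "mat_trace (ind g) = of_int (\<Sum>i<n. c (inv (x i) \<otimes> g \<otimes> x i))"
  by (simp add: mat_trace_def ind_def)

text \<open>Modulo 2 the trace of \<open>g\<close> counts its fixed points on the cosets of \<open>T\<close>.\<close>

lemma odd_trace_ind:
  assumes g: "g \<in> carrier G" and pow: "g [^] (2 ^ k :: nat) = \<one>" and n: "odd n"
  shows "odd (\<Sum>i<n. c (inv (x i) \<otimes> g \<otimes> x i))"
proof -
  \<comment> \<open>The action of \<open>h\<close> on the left cosets of \<open>T\<close>, written
    on their indices.\<close>
  let ?f = "\<lambda>h i. idx (h \<otimes> x i)"
  have f_n: "?f h i < n" if "h \<in> carrier G" "i < n" for h i
    using idx(1)[of "h \<otimes> x i"] that x_closed by simp
  have f_mult: "?f (h \<otimes> h') i = ?f h (?f h' i)" if h: "h \<in> carrier G" "h' \<in> carrier G" and i: "i < n" for h h' i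
  proof -
    let ?a = "?f h' i" and ?b = "?f h (?f h' i)"
    have an: "?a < n" and bn: "?b < n" using f_n h i by blast+
    note cl = x_closed[OF i] x_closed[OF an] x_closed[OF bn]
    have "inv (x ?b) \<otimes> (h \<otimes> x ?a) \<in> T" "inv (x ?a) \<otimes> (h' \<otimes> x i) \<in> T"
      using idx(2)[of "h \<otimes> x ?a"] idx(2)[of "h' \<otimes> x i"] h cl by simp_all
    then have "(inv (x ?b) \<otimes> (h \<otimes> x ?a)) \<otimes> (inv (x ?a) \<otimes> (h' \<otimes> x i)) \<in> T" by (rule T.m_closed)
    moreover have "(inv (x ?b) \<otimes> (h \<otimes> x ?a)) \<otimes> (inv (x ?a) \<otimes> (h' \<otimes> x i)) = inv (x ?b) \<otimes> (h \<otimes> h' \<otimes> x i)"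
      using h cl by (simp add: m_assoc inv_mult_cancel)
    ultimately have "inv (x ?b) \<otimes> (h \<otimes> h' \<otimes> x i) \<in> T" by simp
    moreover have "h \<otimes> h' \<otimes> x i \<in> carrier G" using h cl by simp
    ultimately show ?thesis using idx_unique[OF _ bn] by metis
  qed
  have f_one: "?f \<one> i = i" if i: "i < n" for i
    using idx_unique[of "\<one> \<otimes> x i" i] x_closed[OF i] i by simp
  have f_pow: "(?f g ^^ m) i = ?f (g [^] m) i" if i: "i < n" for i m
  proof (induction m)
    case 0 then show ?case using f_one[OF i] by simp
  next
    case (Suc m)
    have "?f (g [^] Suc m) i = ?f (g \<otimes> g [^] m) i" using g by (simp only: nat_pow_Suc2)
    also have "\<dots> = ?f g (?f (g [^] m) i)" using f_mult[OF g nat_pow_closed[OF g] i] .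
    finally show ?case using Suc by simp
  qed
  have "even (card {i \<in> {..<n}. ?f g i = i}) \<longleftrightarrow> even (card {..<n})"
  proof (rule even_card_fixed_points)
    show "(?f g ^^ (2 ^ k)) i = i" if "i \<in> {..<n}" for i
      using f_pow[of i "2 ^ k"] pow f_one[of i] that by simp
  qed (use f_n[OF g] in simp_all)
  then have fixed: "odd (card {i \<in> {..<n}. ?f g i = i})" using n by simp
  have iff: "inv (x i) \<otimes> g \<otimes> x i \<in> T \<longleftrightarrow> ?f g i = i" if i: "i < n" for i
  proof -
    have gx: "g \<otimes> x i \<in> carrier G" using g x_closed[OF i] by simp
    have "inv (x i) \<otimes> g \<otimes> x i = inv (x i) \<otimes> (g \<otimes> x i)" using g x_closed[OF i] by (simp add: m_assoc)
    then show ?thesis using idx_unique[OF gx i] idx(2)[OF gx] by metis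
  qed
  have "odd (c (inv (x i) \<otimes> g \<otimes> x i)) \<longleftrightarrow> ?f g i = i" if "i < n" for i
    using iff[OF that] sign[of "inv (x i) \<otimes> g \<otimes> x i"] by (auto simp: c_def)
  then have "{i \<in> {..<n}. odd (c (inv (x i) \<otimes> g \<otimes> x i))} = {i \<in> {..<n}. ?f g i = i}" by blast
  then show ?thesis using fixed by (simp add: even_sum_iff)
qed

end

text \<open>Inverting representatives of the right cosets counted by \<open>rcosets\<close> gives
  representatives of the left cosets, so the two numbers agree.\<close>

lemma (in group) ex_transversal:
  assumes T: "subgroup T G" and fin: "finite (carrier G)"
  obtains x where "\<And>i. i < card (rcosets T) \<Longrightarrow> x i \<in> carrier G"
    "\<And>g. g \<in> carrier G \<Longrightarrow> \<exists>!i. i < card (rcosets T) \<and> inv (x i) \<otimes> g \<in> T"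
proof -
  interpret T: subgroup T G by fact
  let ?n = "card (rcosets T)"
  have "finite (rcosets T)" using fin by (simp add: RCOSETS_def)
  then obtain f where f: "bij_betw f {..<?n} (rcosets T)"
    using ex_bij_betw_nat_finite by (metis atLeast0LessThan)
  have "\<exists>y\<in>carrier G. f i = T #> y" if "i < ?n" for i
  proof -
    have "f i \<in> rcosets T" using f that by (simp add: bij_betw_apply)
    then show ?thesis by (auto simp: RCOSETS_def)
  qed
  then obtain y where y: "\<And>i. i < ?n \<Longrightarrow> y i \<in> carrier G" "\<And>i. i < ?n \<Longrightarrow> f i = T #> y i" by metis
  show thesis
  proof
    show "inv (y i) \<in> carrier G" if "i < ?n" for i using y(1)[OF that] by simp
    show "\<exists>!i. i < ?n \<and> inv (inv (y i)) \<otimes> g \<in> T" if g: "g \<in> carrier G" for g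
    proof -
      have iff: "inv (inv (y i)) \<otimes> g \<in> T \<longleftrightarrow> f i = T #> inv g" if i: "i < ?n" for i
      proof -
        have "y i \<otimes> inv (inv g) \<in> T \<longleftrightarrow> y i \<in> T #> inv g"
          using T.rcos_module[OF is_group, of "inv g" "y i"] g y(1)[OF i] by simp
        also have "\<dots> \<longleftrightarrow> T #> y i = T #> inv g"
        proof
          assume "y i \<in> T #> inv g"
          from repr_independence[OF this _ T] show "T #> y i = T #> inv g" using g by simp
        next
          assume "T #> y i = T #> inv g"
          from this[symmetric] show "y i \<in> T #> inv g" using rcos_self[OF y(1)[OF i] T] by (simp only:)
        qed
        finally show ?thesis using y(1,2)[OF i] g by simp
      qed
      have "T #> inv g \<in> rcosets T" using g T.subset by (simp add: rcosetsI)
      then have "T #> inv g \<in> f ` {..<?n}" using f by (simp add: bij_betw_def)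
      then obtain i where i: "i < ?n" "f i = T #> inv g" by (metis imageE lessThan_iff)
      show ?thesis
      proof (rule ex1I[of _ i])
        show "i < ?n \<and> inv (inv (y i)) \<otimes> g \<in> T" using i iff by blast
        fix j assume j: "j < ?n \<and> inv (inv (y j)) \<otimes> g \<in> T"
        then have "f j = f i" using iff[of j] i(2) by simp
        then show "j = i" using f j i(1) by (simp add: bij_betw_def inj_on_def)
      qed
    qed
  qed
qed

section \<open>Comparing linear and nonlinear characters\<close>

text \<open>The trace is recorded as an integer \<open>\<tau> g\<close> so that its parity makes
  sense; oddness is the form in which nonvanishing at 2-elements is obtained.\<close>

lemma (in group) ex_odd_monomial_representation:
  assumes fin: "finite (carrier G)" and om: "odd_monomial G N T l"
  obtains n \<rho> \<tau> where "irreducible_rep G n \<rho>" "odd n" "3 \<le> n"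
    "\<And>g. g \<in> carrier G \<Longrightarrow> mat_trace (\<rho> g) = of_int (\<tau> g)"
    "\<And>g k. g \<in> carrier G \<Longrightarrow> g [^] (2 ^ k :: nat) = \<one> \<Longrightarrow> odd (\<tau> g)"
proof -
  have om': "N \<lhd> G" "N \<subseteq> T" "subgroup T G" "T \<noteq> carrier G" "odd (card (rcosets T))"
    "\<And>t. t \<in> T \<Longrightarrow> l t = 1 \<or> l t = -1"
    "\<And>s t. s \<in> T \<Longrightarrow> t \<in> T \<Longrightarrow> l (s \<otimes> t) = l s * l t"
    "\<And>x. x \<in> carrier G - T \<Longrightarrow> \<exists>n\<in>N. l (inv x \<otimes> n \<otimes> x) \<noteq> l n"
    using om unfolding odd_monomial_def by blast+
  let ?n = "card (rcosets T)"
  obtain x where x: "\<And>i. i < ?n \<Longrightarrow> x i \<in> carrier G"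
    "\<And>g. g \<in> carrier G \<Longrightarrow> \<exists>!i. i < ?n \<and> inv (x i) \<otimes> g \<in> T"
    by (rule ex_transversal[OF om'(3) fin]) (rule that)
  have n0: "?n > 0" using om'(5) by (rule odd_pos)
  interpret monomial_representation G N T l x ?n
    by (intro monomial_representation.intro monomial_representation_axioms.intro is_group om' x n0)
  have "?n \<noteq> 1"
  proof
    assume "?n = 1"
    then have "card T = card (carrier G)" using lagrange[OF om'(3)] by (simp add: Coset.order_def)
    then have "T = carrier G" by (rule card_subset_eq[OF fin T.subset])
    with om'(4) show False by blast
  qed
  then have "3 \<le> ?n" using om'(5) by presburger
  then show thesis
    by (rule that[OF irreducible_ind om'(5) _ trace_ind odd_trace_ind[OF _ _ om'(5)]])
qed

section \<open>Degrees, linear characters and twists\<close>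

lemma (in group) char_degree_rep_char:
  assumes "\<rho> \<in> hom G (GL n)"
  shows "char_degree G (rep_char G \<rho>) = n"
proof -
  have "rep_char G \<rho> \<one> = of_nat n"
    using assms by (simp add: rep_char_def hom_GL_iff mat_trace_def)
  then show ?thesis by (auto simp: char_degree_def)
qed

lemma (in group) IrrE:
  assumes "\<chi> \<in> Irr G"
  obtains n \<rho> where "irreducible_rep G n \<rho>" "\<chi> = rep_char G \<rho>" "char_degree G \<chi> = n"
proof -
  obtain n \<rho> where irr: "irreducible_rep G n \<rho>" and \<chi>: "\<chi> = rep_char G \<rho>"
    using assms unfolding Irr_def by blast
  have hom: "\<rho> \<in> hom G (GL n)" using irr unfolding irreducible_rep_def by blast
  show thesis by (rule that[OF irr \<chi>]) (simp add: \<chi> char_degree_rep_char[OF hom])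
qed

lemma (in group) char_degree_pos:
  assumes "\<chi> \<in> Irr G"
  shows "char_degree G \<chi> > 0"
  using assms by (elim IrrE) (simp add: irreducible_rep_def)

lemma (in group) linear_character_mult:
  assumes "\<chi> \<in> Irr G" "char_degree G \<chi> = 1"
  shows "\<chi> \<one> = 1" and "\<And>g h. g \<in> carrier G \<Longrightarrow> h \<in> carrier G \<Longrightarrow> \<chi> (g \<otimes> h) = \<chi> g * \<chi> h"
proof -
  obtain \<rho> where \<rho>: "irreducible_rep G 1 \<rho>" "\<chi> = rep_char G \<rho>"
    using assms by (metis IrrE)
  then have h: "\<And>g. g \<in> carrier G \<Longrightarrow> \<rho> g \<in> carrier_mat 1 1"
    "\<And>g h. g \<in> carrier G \<Longrightarrow> h \<in> carrier G \<Longrightarrow> \<rho> (g \<otimes> h) = \<rho> g * \<rho> h" "\<rho> \<one> = 1\<^sub>m 1"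
    unfolding irreducible_rep_def hom_GL_iff by blast+
  have \<chi>: "\<chi> g = \<rho> g $$ (0, 0)" if "g \<in> carrier G" for g
    using h(1)[OF that] that by (simp add: \<rho>(2) rep_char_def mat_trace_def)
  show "\<chi> \<one> = 1" using \<chi>[of \<one>] h(3) by simp
  show "\<chi> (g \<otimes> h') = \<chi> g * \<chi> h'" if "g \<in> carrier G" "h' \<in> carrier G" for g h'
    using h(1)[OF that(1)] h(1)[OF that(2)] h(2)[OF that] that by (simp add: \<chi> scalar_prod_def)
qed

text \<open>The scalar \<open>\<mu> g\<close> is never 0, so a subspace invariant under the twist is
  already invariant under \<open>\<rho>\<close>.\<close>

lemma (in group) irreducible_rep_twist:
  assumes irr: "irreducible_rep G n \<rho>" and one: "\<mu> \<one> = 1"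
    and mult: "\<And>g h. g \<in> carrier G \<Longrightarrow> h \<in> carrier G \<Longrightarrow> \<mu> (g \<otimes> h) = \<mu> g * \<mu> h"
  shows "irreducible_rep G n (\<lambda>g. \<mu> g \<cdot>\<^sub>m \<rho> g)"
proof -
  have \<rho>: "\<And>g. g \<in> carrier G \<Longrightarrow> \<rho> g \<in> carrier_mat n n"
    "\<And>g h. g \<in> carrier G \<Longrightarrow> h \<in> carrier G \<Longrightarrow> \<rho> (g \<otimes> h) = \<rho> g * \<rho> h" "\<rho> \<one> = 1\<^sub>m n"
    using irr unfolding irreducible_rep_def hom_GL_iff by blast+
  have nz: "\<mu> g \<noteq> 0" if "g \<in> carrier G" for g
    using mult[OF that inv_closed[OF that]] one that by auto
  have "(\<mu> g * \<mu> h) \<cdot>\<^sub>m (\<rho> g * \<rho> h) = (\<mu> g \<cdot>\<^sub>m \<rho> g) * (\<mu> h \<cdot>\<^sub>m \<rho> h)"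
    if "g \<in> carrier G" "h \<in> carrier G" for g h
    using \<rho>(1)[OF that(1)] \<rho>(1)[OF that(2)]
    by (intro eq_matI) (auto simp: scalar_prod_def sum_distrib_left intro!: sum.cong)
  then have hom: "(\<lambda>g. \<mu> g \<cdot>\<^sub>m \<rho> g) \<in> hom G (GL n)"
    using \<rho> one mult unfolding hom_GL_iff by (auto intro!: eq_matI)
  have "invariant_subspace G n \<rho> W" if inv: "invariant_subspace G n (\<lambda>g. \<mu> g \<cdot>\<^sub>m \<rho> g) W" for W
  proof (rule invariant_subspaceI)
    note W = invariant_subspaceD[OF inv]
    show "\<rho> g *\<^sub>v w \<in> W" if g: "g \<in> carrier G" and w: "w \<in> W" for g w
    proof -
      have "w \<in> carrier_vec n" using W(1) w by blast
      then have "(1 / \<mu> g) \<cdot>\<^sub>v ((\<mu> g \<cdot>\<^sub>m \<rho> g) *\<^sub>v w) = \<rho> g *\<^sub>v w"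
        using \<rho>(1)[OF g] nz[OF g]
        by (intro eq_vecI) (auto simp: scalar_prod_def sum_distrib_left)
      with W(4)[OF W(5)[OF g w], of "1 / \<mu> g"] show ?thesis by simp
    qed
  qed (rule invariant_subspaceD[OF inv]; assumption)+
  then show ?thesis using irr hom unfolding irreducible_rep_def by blast
qed

lemma real_root_of_unity:
  fixes z :: complex
  assumes "z \<in> \<real>" "z ^ m = 1" "m > 0"
  shows "z = 1 \<or> z = -1"
proof -
  obtain r where r: "z = of_real r" using assms(1) by (rule Reals_cases)
  have "norm z = 1" using power_eq_1_iff[OF assms(2)] assms(3) by simp
  then have "\<bar>r\<bar> = 1" unfolding r by simp
  then have "r = 1 \<or> r = -1" by arith
  then show ?thesis unfolding r by auto
qed

text \<open>Letting \<open>X\<close> be any set between the odd-degree characters over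
  \<open>k\<close> and all characters over \<open>k\<close> covers the four averages at once. Inside
  the reals, linear characters over \<open>k\<close> take the values 1 and -1; integers and products
  in \<open>k\<close> keep the twists over \<open>k\<close>.\<close>

lemma (in group) two_le_average_degree:
  assumes fin: "finite (carrier G)" and om: "odd_monomial G N T l"
    and k: "k \<subseteq> \<real>" "\<int> \<subseteq> k" "\<And>a b. a \<in> k \<Longrightarrow> b \<in> k \<Longrightarrow> a * b \<in> k"
    and X: "X \<subseteq> Irr_over k G" "\<And>\<chi>. \<chi> \<in> Irr_over k G \<Longrightarrow> odd (char_degree G \<chi>) \<Longrightarrow> \<chi> \<in> X"
  shows "2 \<le> average_degree G X"
proof -
  obtain n \<rho> \<tau> where irr: "irreducible_rep G n \<rho>" and n: "odd n" "3 \<le> n"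
    and \<tau>: "\<And>g. g \<in> carrier G \<Longrightarrow> mat_trace (\<rho> g) = of_int (\<tau> g)"
    and odd: "\<And>g k. g \<in> carrier G \<Longrightarrow> g [^] (2 ^ k :: nat) = \<one> \<Longrightarrow> odd (\<tau> g)"
    by (rule ex_odd_monomial_representation[OF fin om]) (rule that)
  have XIrr: "X \<subseteq> Irr G" using X(1) unfolding Irr_over_def by blast
  have finX: "finite X" using finite_Irr[OF fin] XIrr finite_subset by blast
  define d where "d = char_degree G"
  define L where "L = {\<chi> \<in> X. d \<chi> = 1}"
  define F where "F = (\<lambda>\<mu>. \<lambda>g\<in>carrier G. \<mu> g * of_int (\<tau> g) :: complex)"
  have L: "\<mu> \<in> Irr G" "char_degree G \<mu> = 1" "\<And>g. g \<in> carrier G \<Longrightarrow> \<mu> g \<in> k" if "\<mu> \<in> L" for \<mu>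
    using that X(1) unfolding L_def d_def Irr_over_def by blast+
  have F: "F \<mu> \<in> X" "d (F \<mu>) = n" if \<mu>: "\<mu> \<in> L" for \<mu>
  proof -
    note lin = linear_character_mult[OF L(1,2)[OF \<mu>]]
    have irr': "irreducible_rep G n (\<lambda>g. \<mu> g \<cdot>\<^sub>m \<rho> g)" using irr lin by (rule irreducible_rep_twist)
    have hom: "\<rho> \<in> hom G (GL n)" "(\<lambda>g. \<mu> g \<cdot>\<^sub>m \<rho> g) \<in> hom G (GL n)"
      using irr irr' unfolding irreducible_rep_def by blast+
    have "mat_trace (\<mu> g \<cdot>\<^sub>m \<rho> g) = \<mu> g * mat_trace (\<rho> g)" if "g \<in> carrier G" for g
      using hom(1) that unfolding hom_GL_iff by (auto simp: mat_trace_def sum_distrib_left)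
    then have eq: "F \<mu> = rep_char G (\<lambda>g. \<mu> g \<cdot>\<^sub>m \<rho> g)"
      unfolding F_def rep_char_def using \<tau> by (intro restrict_ext) simp
    show deg: "d (F \<mu>) = n" unfolding d_def eq using hom(2) by (rule char_degree_rep_char)
    have "F \<mu> \<in> Irr G" unfolding eq Irr_def using irr' by blast
    moreover have "F \<mu> g \<in> k" if "g \<in> carrier G" for g
      using k(3)[OF L(3)[OF \<mu> that] subsetD[OF k(2) Ints_of_int]] that by (simp add: F_def)
    ultimately have "F \<mu> \<in> Irr_over k G" unfolding Irr_over_def by blast
    then show "F \<mu> \<in> X" using X(2) deg n(1) unfolding d_def by blast
  qed
  \<comment> \<open>Real linear characters take the values \<open>1\<close> and \<open>-1\<close>, so they are determined by their values
    on the elements of 2-power order, where \<open>\<tau>\<close> is odd and hence nonzero.\<close>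
  have "inj_on F L"
  proof (rule inj_onI)
    fix \<mu> \<nu> assume \<mu>: "\<mu> \<in> L" and \<nu>: "\<nu> \<in> L" and eq: "F \<mu> = F \<nu>"
    let ?o = "Coset.order G"
    have o0: "?o > 0" using order_gt_0_iff_finite fin by blast
    \<comment> \<open>\<open>m\<close> is the odd part of the group order, so \<open>g [^] m\<close>
      has 2-power order for every \<open>g\<close>.\<close>
    obtain m where m: "?o = 2 ^ multiplicity 2 ?o * m" "\<not> 2 dvd m"
      using multiplicity_decompose'[of ?o 2] o0 by (metis less_not_refl not_prime_unit two_is_prime_nat)
    have pow: "\<chi> (g [^] i) = \<chi> g ^ i" if "\<chi> \<in> L" "g \<in> carrier G" for \<chi> g and i :: nat
      using linear_character_mult[OF L(1,2)[OF that(1)]] that(2) by (induction i) simp_all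
    have pm: "\<chi> g = 1 \<or> \<chi> g = -1" if \<chi>: "\<chi> \<in> L" and g: "g \<in> carrier G" for \<chi> g
    proof (rule real_root_of_unity[of _ ?o])
      show "\<chi> g \<in> \<real>" using L(3)[OF \<chi> g] k(1) by blast
      show "\<chi> g ^ ?o = 1"
        using pow[OF \<chi> g, of ?o] pow_order_eq_1[OF g] linear_character_mult(1)[OF L(1,2)[OF \<chi>]] by simp
    qed (rule o0)
    have "\<mu> g = \<nu> g" if g: "g \<in> carrier G" for g
    proof -
      let ?h = "g [^] m"
      have h: "?h \<in> carrier G" using g by simp
      have "?h [^] (2 ^ multiplicity 2 ?o :: nat) = g [^] ?o"
        using g m(1) by (simp add: nat_pow_pow mult.commute)
      then have "odd (\<tau> ?h)" using odd[OF h] pow_order_eq_1[OF g] by simp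
      then have "\<tau> ?h \<noteq> 0" by (metis even_zero)
      moreover have "F \<mu> ?h = F \<nu> ?h" using eq by simp
      ultimately have "\<mu> ?h = \<nu> ?h" using h by (simp add: F_def)
      \<comment> \<open>A sign equals its own odd powers.\<close>
      have "\<chi> ?h = \<chi> g" if "\<chi> \<in> L" for \<chi>
        using pow[OF that g, of m] pm[OF that g] m(2) by auto
      from this[OF \<mu>] this[OF \<nu>] \<open>\<mu> ?h = \<nu> ?h\<close> show ?thesis by simp
    qed
    moreover have "\<chi> \<in> extensional (carrier G)" if "\<chi> \<in> L" for \<chi>
      using L(1)[OF that] by (auto simp: Irr_def rep_char_def)
    ultimately show "\<mu> = \<nu>" using \<mu> \<nu> by (intro extensionalityI[of _ "carrier G"]) auto
  qed
  then have cardF: "card (F ` L) = card L" by (rule card_image)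
  have finL: "finite L" using finX unfolding L_def by simp
  let ?R = "X - L - F ` L"
  have disj: "L \<inter> F ` L = {}"
  proof -
    have "d \<chi> = 1" if "\<chi> \<in> L" for \<chi> using that unfolding L_def by blast
    then show ?thesis using F(2) n(2) by fastforce
  qed
  have split: "X = (L \<union> F ` L) \<union> ?R" using F(1) unfolding L_def by blast
  have sum_split: "(\<Sum>\<chi>\<in>X. f \<chi>) = (\<Sum>\<chi>\<in>L. f \<chi>) + (\<Sum>\<chi>\<in>F ` L. f \<chi>) + (\<Sum>\<chi>\<in>?R. f \<chi>)" for f :: "_ \<Rightarrow> nat"
  proof -
    have "(\<Sum>\<chi>\<in>X. f \<chi>) = (\<Sum>\<chi>\<in>L \<union> F ` L. f \<chi>) + (\<Sum>\<chi>\<in>?R. f \<chi>)"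
      using finX finL by (subst split, intro sum.union_disjoint) auto
    also have "(\<Sum>\<chi>\<in>L \<union> F ` L. f \<chi>) = (\<Sum>\<chi>\<in>L. f \<chi>) + (\<Sum>\<chi>\<in>F ` L. f \<chi>)"
      using finL disj by (intro sum.union_disjoint) auto
    finally show ?thesis .
  qed
  have sL: "(\<Sum>\<chi>\<in>L. d \<chi>) = card L" by (simp add: L_def)
  have "(\<Sum>\<chi>\<in>F ` L. n) = (\<Sum>\<chi>\<in>F ` L. d \<chi>)" using F(2) by (intro sum.cong) auto
  then have sF: "(\<Sum>\<chi>\<in>F ` L. d \<chi>) = card L * n" using cardF by simp
  have "(\<Sum>\<chi>\<in>?R. 2) \<le> (\<Sum>\<chi>\<in>?R. d \<chi>)"
  proof (rule sum_mono)
    fix \<chi> assume "\<chi> \<in> ?R"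
    then have "\<chi> \<in> Irr G" "d \<chi> \<noteq> 1" using XIrr unfolding L_def by blast+
    then show "2 \<le> d \<chi>" using char_degree_pos[of \<chi>] unfolding d_def by linarith
  qed
  then have sR: "2 * card ?R \<le> (\<Sum>\<chi>\<in>?R. d \<chi>)" by simp
  have cX: "card X = card L + card L + card ?R"
    using sum_split[of "\<lambda>_. 1"] cardF by simp
  have "card L * 3 \<le> card L * n" using n(2) by simp
  then have "2 * card X \<le> (\<Sum>\<chi>\<in>X. d \<chi>)"
    using sum_split[of d] sL sF sR cX by linarith
  then have ge: "2 * real (card X) \<le> (\<Sum>\<chi>\<in>X. real (d \<chi>))"
    by (metis of_nat_le_iff of_nat_mult of_nat_numeral of_nat_sum)
  \<comment> \<open>\<open>X\<close> has to be nonempty, since division by 0 would make the average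
    of the empty set 0.\<close>
  have "rep_char G \<rho> \<in> X"
  proof (rule X(2))
    have "rep_char G \<rho> g \<in> k" if "g \<in> carrier G" for g
      using k(2) \<tau>[OF that] that by (auto simp: rep_char_def)
    then show "rep_char G \<rho> \<in> Irr_over k G" using irr unfolding Irr_over_def Irr_def by blast
    show "odd (char_degree G (rep_char G \<rho>))"
      using char_degree_rep_char[of \<rho> n] irr n(1) unfolding irreducible_rep_def by simp
  qed
  then have "card X > 0" using finX card_gt_0_iff by blast
  then show ?thesis using ge by (simp add: average_degree_def d_def pos_le_divide_eq)
qed

theorem theorem1p3:
  fixes G :: "('a, 'b) monoid_scheme"
  assumes "group G" and "finite (carrier G)" and "solvable G"
    and "acd_p' \<rat> 2 G < 2 \<or> acd \<rat> G < 2 \<or> acd_p' \<real> 2 G < 2 \<or> acd \<real> G < 2"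
  shows "p_nilpotent 2 G"
proof (rule ccontr)
  interpret group G by fact
  assume "\<not> p_nilpotent 2 G"
  then obtain N T l where om: "odd_monomial G N T l" by (rule ex_odd_monomial[OF assms(2,3)])
  have R: "(\<int> :: complex set) \<subseteq> \<real>"
    by (rule subsetI, erule Ints_cases) simp
  have Q: "(\<rat> :: complex set) \<subseteq> \<real>"
    by (rule subsetI, erule Rats_cases') simp
  note ge = two_le_average_degree[OF assms(2) om]
  have "2 \<le> acd \<rat> G"
    unfolding acd_def by (rule ge[OF Q Ints_subset_Rats Rats_mult subset_refl])
  moreover have "2 \<le> acd \<real> G"
    unfolding acd_def by (rule ge[OF subset_refl R Reals_mult subset_refl])
  moreover have "2 \<le> acd_p' \<rat> 2 G"
    unfolding acd_p'_def Irr_over_p'_def by (rule ge[OF Q Ints_subset_Rats Rats_mult]) blast+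
  moreover have "2 \<le> acd_p' \<real> 2 G"
    unfolding acd_p'_def Irr_over_p'_def by (rule ge[OF subset_refl R Reals_mult]) blast+
  ultimately show False using assms(4) by linarith
qed

end
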